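(* Let $(X,d,\mathfrak{m})$ be a metric measure space. Let $(d_i)_{i\in\mathbb{N}}$ be a sequence of complete distances on $X$ such that $d_i\nearrow d$ as $i\to\infty$ (that is, $d_i(x,y)\le d_{i+1}(x,y)$ for all $i$ and $\lim_{i\to\infty}d_i(x,y)=d(x,y)$, for all $x,y\in X$), and such that for every $i\in\mathbb{N}$ the distances $d_i$ and $d$ induce the same topology on $X$. Suppose that $\mathfrak{m}$ is finite on $d_i$-bounded Borel sets for every $i\in\mathbb{N}$ (so that each $(X,d_i,\mathfrak{m})$ is a metric measure space). Fix $p\in(1,\infty)$. Then the Cheeger $p$-energies $\mathcal{E}_{\mathrm{Ch},p}^{d_i}$ Mosco-converge to $\mathcal{E}_{\mathrm{Ch},p}^{d}$ as $i\to\infty$, i.e. the following two properties hold: (i) (Weak $\Gamma$-liminf.) If $(f_i)_{i\in\mathbb{N}}\subseteq L^p(\mathfrak{m})$ converges weakly in $L^p(\mathfrak{m})$ to $f\in L^p(\mathfrak{m})$, then $$\mathcal{E}_{\mathrm{Ch},p}^{d}(f)\le\liminf_{i\to\infty}\mathcal{E}_{\mathrm{Ch},p}^{d_i}(f_i).$$ (ii) (Strong $\Gamma$-limsup.) For every $f\in L^p(\mathfrak{m})$ there exists a sequence $(f_i)_{i\in\mathbb{N}}\subseteq L^p(\mathfrak{m})$ converging strongly in $L^p(\mathfrak{m})$ to $f$ such that $$\mathcal{E}_{\mathrm{Ch},p}^{d}(f)\ge\limsup_{i\to\infty}\mathcal{E}_{\mathrm{Ch},p}^{d_i}(f_i).$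$
   Context: A metric measure space $(X,d,\mathfrak{m})$ is a complete separable metric space $(X,d)$ endowed with a Borel measure $\mathfrak{m}\ge 0$ that is boundedly finite, i.e. finite on $d$-bounded Borel sets. For a distance $d$ on $X$, let $\mathrm{LIP}_d(X)$ be the space of $d$-Lipschitz functions $f:X\to\mathbb{R}$. For $f\in\mathrm{LIP}_d(X)$ and $E\subseteq X$ set $$\mathrm{Lip}_d(f;E):=\sup\Big\{\tfrac{|f(x)-f(y)|}{d(x,y)}: x,y\in E,\ x\ne y\Big\},$$ with value $0$ if $E$ is empty or a singleton. The asymptotic slope is $\mathrm{lip}_a^d(f)(x):=\inf_{r>0}\mathrm{Lip}_d(f;B_r^d(x))$, $x\in X$, where $B_r^d(x)=\{y\in X: d(x,y)<r\}$. A function is boundedly-supported (with respect to $d$) if its support, the closure of $\{f\neq0\}$, is $d$-bounded. For a metric measure space $(X,d,\mathfrak{m})$ and $p\in(1,\infty)$, the asymptotic $p$-energy of a boundedly-supported $f\in\mathrm{LIP}_d(X)$ is $\mathcal{E}_{a,p}^d(f):=\frac1p\int \mathrm{lip}_a^d(f)^p\,d\mathfrak{m}$ (and $+\infty$ for all other elements of $L^p(\mathfrak{m})$). The Cheeger $p$-energy $\mathcal{E}_{\mathrm{Ch},p}^d:L^p(\mathfrak{m})\to[0,+\infty]$ is its $L^p(\mathfrak{m})$-lower semicontinuous envelope: $\mathcal{E}_{\mathrm{Ch},p}^d(f)$ is the infimum of $\liminf_{n\to\infty}\mathcal{E}_{a,p}^d(f_n)$ over all sequences $(f_n)_n\subseteq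 L^p(\mathfrak{m})$ with $f_n\to f$ strongly in $L^p(\mathfrak{m})$ (equivalently, over sequences of boundedly-supported $f_n\in\mathrm{LIP}_d(X)$, with the infimum of the empty set being $+\infty$). The energies $\mathcal{E}_{\mathrm{Ch},p}^{d_i}$ are defined in the same way from $(X,d_i,\mathfrak{m})$. *)

theory Defs
  imports "HOL-Analysis.Analysis"
begin

context Metric_space
begin

text \<open>Membership in \<open>sets m\<close> plays the role of being Borel.\<close>

definition boundedly_finite :: "'a measure \<Rightarrow> bool" where
  "boundedly_finite m \<longleftrightarrow> (\<forall>B \<in> sets m. mbounded B \<longrightarrow> emeasure m B < \<infinity>)"

definition LIP :: "('a \<Rightarrow> real) set" where
  "LIP = {f. Lipschitz_continuous_map (metric (M, d)) euclidean_metric f}"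

definition boundedly_supported :: "('a \<Rightarrow> real) \<Rightarrow> bool" where
  "boundedly_supported f \<longleftrightarrow> mbounded (mtopology closure_of {x \<in> M. f x \<noteq> 0})"

text \<open>
  The suprema and infima below are taken in the reals. They are meaningful for \<open>f \<in> LIP\<close>
  and \<open>E \<subseteq> M\<close>, where the set of difference quotients is bounded above; they are used only there.
\<close>

definition Lip_const :: "('a \<Rightarrow> real) \<Rightarrow> 'a set \<Rightarrow> real" where
  "Lip_const f E =
     (if \<exists>x\<in>E. \<exists>y\<in>E. x \<noteq> y
      then Sup {\<bar>f x - f y\<bar> / d x y | x y. x \<in> E \<and> y \<in> E \<and> x \<noteq> y}
      else 0)"

definition asymptotic_slope :: "('a \<Rightarrow> real) \<Rightarrow> 'a \<Rightarrow> real" where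
  "asymptotic_slope f x = (INF r\<in>{0<..}. Lip_const f (mball x r))"

end

locale metric_measure_space = Metric_space X d
  for X :: "'a set" and d :: "'a \<Rightarrow> 'a \<Rightarrow> real" +
  fixes m :: "'a measure"
  assumes complete: "mcomplete"
    and separable: "separable_space mtopology"
    and borel: "sets m = sets (sigma X {U. openin mtopology U})"
    and boundedly_finite: "boundedly_finite m"

text \<open>
  Elements of \<open>L\<^sup>p\<close> are represented by functions; two functions represent the same element
  iff they agree almost everywhere.
\<close>

definition Lp :: "'a measure \<Rightarrow> real \<Rightarrow> ('a \<Rightarrow> real) set" where
  "Lp m p = {f \<in> borel_measurable m. integrable m (\<lambda>x. \<bar>f x\<bar> powr p)}"

definition Lp_norm :: "'a measure \<Rightarrow> real \<Rightarrow> ('a \<Rightarrow> real) \<Rightarrow> real" where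
  "Lp_norm m p f = (LINT x|m. \<bar>f x\<bar> powr p) powr (1 / p)"

definition Lp_converges :: "'a measure \<Rightarrow> real \<Rightarrow> (nat \<Rightarrow> 'a \<Rightarrow> real) \<Rightarrow> ('a \<Rightarrow> real) \<Rightarrow> bool" where
  "Lp_converges m p fs f \<longleftrightarrow>
     (\<forall>n. fs n \<in> Lp m p) \<and> f \<in> Lp m p \<and>
     (\<lambda>n. Lp_norm m p (\<lambda>x. fs n x - f x)) \<longlonglongrightarrow> 0"

text \<open>
  The bound makes such a functional insensitive to changes of its argument on a null set,
  so these are exactly the continuous linear functionals on the space of equivalence classes.
\<close>

definition Lp_dual :: "'a measure \<Rightarrow> real \<Rightarrow> (('a \<Rightarrow> real) \<Rightarrow> real) set" where
  "Lp_dual m p = {\<phi>.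
     (\<forall>f\<in>Lp m p. \<forall>g\<in>Lp m p. \<phi> (\<lambda>x. f x + g x) = \<phi> f + \<phi> g) \<and>
     (\<forall>c. \<forall>f\<in>Lp m p. \<phi> (\<lambda>x. c * f x) = c * \<phi> f) \<and>
     (\<exists>C. \<forall>f\<in>Lp m p. \<bar>\<phi> f\<bar> \<le> C * Lp_norm m p f)}"

definition Lp_converges_weakly ::
  "'a measure \<Rightarrow> real \<Rightarrow> (nat \<Rightarrow> 'a \<Rightarrow> real) \<Rightarrow> ('a \<Rightarrow> real) \<Rightarrow> bool" where
  "Lp_converges_weakly m p fs f \<longleftrightarrow>
     (\<forall>n. fs n \<in> Lp m p) \<and> f \<in> Lp m p \<and>
     (\<forall>\<phi>\<in>Lp_dual m p. (\<lambda>n. \<phi> (fs n)) \<longlonglongrightarrow> \<phi> f)"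

context Metric_space
begin

text \<open>
  The asymptotic energy depends on the representative when the support of \<open>m\<close> is not the whole
  space. The Cheeger energy does not: its infimum runs over all approximating sequences of
  representatives, so a class may be approximated through any Lipschitz representatives.
\<close>

definition asymptotic_energy :: "'a measure \<Rightarrow> real \<Rightarrow> ('a \<Rightarrow> real) \<Rightarrow> ennreal" where
  "asymptotic_energy m p f =
     (if f \<in> LIP \<and> boundedly_supported f
      then ennreal (1 / p) * (\<integral>\<^sup>+ x. ennreal (asymptotic_slope f x powr p) \<partial>m)
      else \<infinity>)"

definition Cheeger_energy :: "'a measure \<Rightarrow> real \<Rightarrow> ('a \<Rightarrow> real) \<Rightarrow> ennreal" where
  "Cheeger_energy m p f =
     (INF fs \<in> {fs. Lp_converges m p fs f}. liminf (\<lambda>n. asymptotic_energy m p (fs n)))"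

end

end

theory Submission
  imports Defs
begin

text \<open>
  \<^bold>\<open>Lower bound.\<close> Every distance \<open>d\<^sub>i\<close> lies below \<open>d\<close>, so a \<open>d\<^sub>i\<close>-Lipschitz function is
  \<open>d\<close>-Lipschitz and its slope can only decrease when \<open>d\<^sub>i\<close> is replaced by \<open>d\<close>. Its support may be
  \<open>d\<close>-unbounded, but multiplication with flat \<open>d\<close>-cutoffs repairs this at an arbitrarily small cost
  (\<open>boundedly_supported_approximation\<close>), because the support has finite measure. Hence, if the energies
  of the \<open>f\<^sub>i\<close> stay below \<open>c\<close> along a subsequence, these \<open>f\<^sub>i\<close> are limits of elements of the
  convex set \<open>K\<close> of functions of asymptotic \<open>d\<close>-energy at most \<open>c\<close>. If \<open>f\<close> had positive distance from
  \<open>K\<close>, a continuous functional would separate it from \<open>K\<close> (\<open>convex_at_distance_separated\<close>) and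
  hence from the \<open>f\<^sub>i\<close>, against weak convergence. So \<open>f\<close> is a limit of elements of \<open>K\<close>, and
  its Cheeger energy is at most \<open>c\<close>. The separation is the Mazur-Orlicz theorem, which follows from
  Zorn's lemma and only needs that the \<open>L\<^sup>p\<close> norm is sublinear.

  \<^bold>\<open>Recovery sequences.\<close> By a diagonal argument (\<open>eventually_diagonal\<close>) it suffices to approximate a
  single \<open>d\<close>-Lipschitz function \<open>g\<close> with bounded support, of Lipschitz constant \<open>L\<close>, by
  \<open>d\<^sub>i\<close>-Lipschitz functions of almost the same energy. Apart from a set of small measure the relevant
  bounded region is covered by finitely many small balls; let \<open>K\<close> now be the covered part. There \<open>d\<^sub>i\<close> is
  uniformly close to \<open>d\<close> for large \<open>i\<close>, since it is close on the finitely many centres. Let \<open>\<rho> y\<close> be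
  the Lipschitz constant of \<open>g\<close> on the \<open>d\<close>-ball of radius \<open>r\<close> around \<open>y\<close>. The function
  \<open>F x = (INF y\<in>K. g y + (\<rho> y + \<epsilon>) * d\<^sub>i x y + 4 * L * max 0 (d\<^sub>i x y - r / 2))\<close>
  is a McShane extension with a cost that depends on the centre. It has \<open>d\<^sub>i\<close>-Lipschitz constant
  \<open>5 * L + \<epsilon>\<close>, whatever \<open>K\<close>, \<open>r\<close> and \<open>i\<close> are, so the set off \<open>K\<close> contributes little
  energy. On \<open>K\<close> it is uniformly close to \<open>g\<close>: centres at distance less than \<open>r\<close> are controlled
  by \<open>\<rho>\<close>, the others by the steep last term. And on \<open>K\<close> its slope is no larger than the Lipschitz
  constant of \<open>g\<close> on the ball of radius \<open>2 * r\<close>, plus \<open>\<epsilon>\<close>: the term \<open>\<epsilon> * d\<^sub>i x y\<close> forces almost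
  minimal centres to be so close to \<open>x\<close> that the steep term vanishes. As \<open>r\<close> and \<open>\<epsilon>\<close> tend to zero
  these bounds converge to the asymptotic slope of \<open>g\<close>. A truncation finally makes the support bounded
  and removes the slope at the points of \<open>K\<close> where \<open>g\<close> vanishes.
\<close>

section \<open>Separation of convex sets by linear functionals\<close>

text \<open>
  Vector spaces of functions are sets here, and not types, because \<open>Lp m p\<close> is a set of representatives
  inside the type of all functions.
\<close>

definition function_space :: "('a \<Rightarrow> real) set \<Rightarrow> bool" where
  "function_space V \<longleftrightarrow>
     (\<lambda>_. 0) \<in> V \<and>
     (\<forall>f\<in>V. \<forall>g\<in>V. (\<lambda>x. f x + g x) \<in> V) \<and>
     (\<forall>c. \<forall>f\<in>V. (\<lambda>x. c * f x) \<in> V)"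

definition sublinear_on :: "('a \<Rightarrow> real) set \<Rightarrow> (('a \<Rightarrow> real) \<Rightarrow> real) \<Rightarrow> bool" where
  "sublinear_on V q \<longleftrightarrow>
     (\<forall>f\<in>V. \<forall>g\<in>V. q (\<lambda>x. f x + g x) \<le> q f + q g) \<and>
     (\<forall>c\<ge>0. \<forall>f\<in>V. q (\<lambda>x. c * f x) = c * q f)"

definition convex_functions :: "('a \<Rightarrow> real) set \<Rightarrow> bool" where
  "convex_functions K \<longleftrightarrow>
     (\<forall>f\<in>K. \<forall>g\<in>K. \<forall>t\<in>{0..1}. (\<lambda>x. t * f x + (1 - t) * g x) \<in> K)"

lemma function_space_zero: "function_space V \<Longrightarrow> (\<lambda>_. 0) \<in> V"
  by (simp add: function_space_def)

lemma function_space_add: "function_space V \<Longrightarrow> f \<in> V \<Longrightarrow> g \<in> V \<Longrightarrow> (\<lambda>x. f x + g x) \<in> V"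
  by (simp add: function_space_def)

lemma function_space_scale: "function_space V \<Longrightarrow> f \<in> V \<Longrightarrow> (\<lambda>x. c * f x) \<in> V"
  by (simp add: function_space_def)

lemma function_space_uminus: "function_space V \<Longrightarrow> f \<in> V \<Longrightarrow> (\<lambda>x. - f x) \<in> V"
  using function_space_scale[of V f "-1"] by simp

lemma sublinear_on_add:
  "sublinear_on V q \<Longrightarrow> f \<in> V \<Longrightarrow> g \<in> V \<Longrightarrow> q (\<lambda>x. f x + g x) \<le> q f + q g"
  by (simp add: sublinear_on_def)

lemma sublinear_on_scale:
  "sublinear_on V q \<Longrightarrow> f \<in> V \<Longrightarrow> 0 \<le> c \<Longrightarrow> q (\<lambda>x. c * f x) = c * q f"
  by (simp add: sublinear_on_def)

lemma sublinear_on_zero: "function_space V \<Longrightarrow> sublinear_on V q \<Longrightarrow> q (\<lambda>_. 0) = 0"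
  using sublinear_on_scale[of V q "\<lambda>_. 0" 0] function_space_zero[of V] by simp

lemma sublinear_on_uminus:
  assumes "function_space V" "sublinear_on V q" "f \<in> V"
  shows "- q (\<lambda>x. - f x) \<le> q f"
  using sublinear_on_add[OF assms(2,3) function_space_uminus[OF assms(1,3)]]
    sublinear_on_zero[OF assms(1,2)] by simp

text \<open>
  The functional is \<open>r f = inf {q (f + t k) - t \<delta> | t \<ge> 0, k \<in> K}\<close>. It is finite because
  \<open>q (t k) \<ge> t \<delta>\<close> keeps it above \<open>- q (- f)\<close>, and convexity of \<open>K\<close> makes it subadditive. It is used twice:
  for a singleton \<open>K\<close> it shows that minimal sublinear functionals are odd, and in general it
  turns the wish for a functional that is large on \<open>K\<close> into a bound from above.
\<close>

lemma sublinear_on_reduction: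
  fixes V :: "('a \<Rightarrow> real) set"
  assumes V: "function_space V" and q: "sublinear_on V q"
    and K: "K \<subseteq> V" "K \<noteq> {}" "convex_functions K" and \<delta>: "\<And>k. k \<in> K \<Longrightarrow> \<delta> \<le> q k"
  obtains r where "sublinear_on V r" "\<And>f. f \<in> V \<Longrightarrow> r f \<le> q f"
    "\<And>k. k \<in> K \<Longrightarrow> r (\<lambda>x. - k x) \<le> - \<delta>"
proof -
  define S where "S = (\<lambda>f. {q (\<lambda>x. f x + t * k x) - t * \<delta> | t k. 0 \<le> t \<and> k \<in> K})"
  define r where "r = (\<lambda>f. Inf (S f))"
  have add: "(\<lambda>x. f x + g x) \<in> V" if "f \<in> V" "g \<in> V" for f g
    using function_space_add[OF V that] .
  have scale: "(\<lambda>x. c * f x) \<in> V" if "f \<in> V" for f c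
    using function_space_scale[OF V that] .
  have qadd: "q (\<lambda>x. f x + g x) \<le> q f + q g" if "f \<in> V" "g \<in> V" for f g
    using sublinear_on_add[OF q that] .
  have qscale: "q (\<lambda>x. c * f x) = c * q f" if "f \<in> V" "c \<ge> 0" for f c
    using sublinear_on_scale[OF q that] .
  have lower: "- q (\<lambda>x. - f x) \<le> q (\<lambda>x. f x + t * k x) - t * \<delta>"
    if "f \<in> V" "0 \<le> t" "k \<in> K" for f t k
  proof -
    have kV: "k \<in> V" using K that by blast
    have "t * \<delta> \<le> q (\<lambda>x. t * k x)"
      using \<delta>[OF that(3)] that(2) qscale[OF kV that(2)] by (simp add: mult_left_mono)
    also have "\<dots> = q (\<lambda>x. (f x + t * k x) + - f x)"
      by (simp add: algebra_simps)
    also have "\<dots> \<le> q (\<lambda>x. f x + t * k x) + q (\<lambda>x. - f x)"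
      using qadd[OF add[OF that(1) scale[OF kV, of t]] function_space_uminus[OF V that(1)]] .
    finally show ?thesis by simp
  qed
  have bdd: "bdd_below (S f)" if "f \<in> V" for f
    unfolding S_def by (rule bdd_belowI[of _ "- q (\<lambda>x. - f x)"]) (use lower that in auto)
  have ne: "S f \<noteq> {}" for f
    using K(2) by (auto simp: S_def)
  have r_le: "r f \<le> q (\<lambda>x. f x + t * k x) - t * \<delta>" if "f \<in> V" "0 \<le> t" "k \<in> K" for f t k
    unfolding r_def by (rule cInf_lower[OF _ bdd[OF that(1)]]) (use that in \<open>auto simp: S_def\<close>)
  have r_ge: "b \<le> r f" if "\<And>t k. 0 \<le> t \<Longrightarrow> k \<in> K \<Longrightarrow> b \<le> q (\<lambda>x. f x + t * k x) - t * \<delta>" for b f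
    unfolding r_def by (rule cInf_greatest[OF ne]) (use that in \<open>auto simp: S_def\<close>)
  have r_le_q: "r f \<le> q f" if "f \<in> V" for f
    using K(2) r_le[OF that, of 0] by auto
  have "r (\<lambda>x. f x + g x) \<le> r f + r g" if f: "f \<in> V" and g: "g \<in> V" for f g
  proof -
    have *: "r (\<lambda>x. f x + g x) \<le> (q (\<lambda>x. f x + s * k x) - s * \<delta>) + (q (\<lambda>x. g x + t * l x) - t * \<delta>)"
      if s: "0 \<le> s" "k \<in> K" and t: "0 \<le> t" "l \<in> K" for s t k l
    proof -
      have kl: "k \<in> V" "l \<in> V" using s t K by auto
      \<comment> \<open>a conic combination of two elements of the convex set \<open>K\<close> is a multiple of a third\<close>
      obtain j where j: "j \<in> K" "\<And>x. s * k x + t * l x = (s + t) * j x"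
      proof (cases "s + t = 0")
        case True
        then have "s = 0" "t = 0" using s t by auto
        then show ?thesis using that[of k] s by simp
      next
        case False
        then have st: "s + t > 0" using s t by simp
        have "(\<lambda>x. s / (s + t) * k x + (1 - s / (s + t)) * l x) \<in> K"
          using K(3)[unfolded convex_functions_def, rule_format, of k l "s / (s + t)"] s t st by auto
        moreover have "s * k x + t * l x = (s + t) * (s / (s + t) * k x + (1 - s / (s + t)) * l x)" for x
        proof -
          have "1 - s / (s + t) = t / (s + t)" using st by (simp add: field_simps)
          then show ?thesis using st by (simp add: distrib_left)
        qed
        ultimately show ?thesis using that by blast
      qed
      have "r (\<lambda>x. f x + g x) \<le> q (\<lambda>x. f x + g x + (s + t) * j x) - (s + t) * \<delta>"
        using r_le[OF add[OF f g] _ j(1)] s t by simp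
      also have "(\<lambda>x. f x + g x + (s + t) * j x) = (\<lambda>x. (f x + s * k x) + (g x + t * l x))"
        by (rule ext) (use j(2) in \<open>simp add: algebra_simps\<close>)
      also have "q \<dots> \<le> q (\<lambda>x. f x + s * k x) + q (\<lambda>x. g x + t * l x)"
        by (intro qadd add scale f g kl)
      finally show ?thesis by (simp add: algebra_simps)
    qed
    have "r (\<lambda>x. f x + g x) - (q (\<lambda>x. g x + t * l x) - t * \<delta>) \<le> r f" if "0 \<le> t" "l \<in> K" for t l
      by (rule r_ge) (use *[OF _ _ that] in \<open>smt (verit)\<close>)
    then have "r (\<lambda>x. f x + g x) - r f \<le> r g"
      by (intro r_ge) (smt (verit))
    then show ?thesis by simp
  qed
  moreover have "r (\<lambda>x. c * f x) = c * r f" if "f \<in> V" "0 \<le> c" for c f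
  proof (cases "c = 0")
    case True
    have "0 \<le> r (\<lambda>_. 0)"
      using r_ge[of 0 "\<lambda>_. 0"] lower[of "\<lambda>_. 0"] sublinear_on_zero[OF V q] V
      by (simp add: function_space_def)
    moreover have "r (\<lambda>_. 0) \<le> 0"
      using r_le_q[of "\<lambda>_. 0"] sublinear_on_zero[OF V q] V by (simp add: function_space_def)
    ultimately show ?thesis using True by simp
  next
    case False
    have le: "r (\<lambda>x. c * f x) \<le> c * r f" if "f \<in> V" "0 < c" for c f
    proof -
      have "r (\<lambda>x. c * f x) / c \<le> r f"
      proof (rule r_ge)
        fix t k assume tk: "(0::real) \<le> t" "k \<in> K"
        have "r (\<lambda>x. c * f x) \<le> q (\<lambda>x. c * f x + (c * t) * k x) - (c * t) * \<delta>"
          using r_le[OF scale[OF that(1)] _ tk(2), of "c * t" c] that tk by simp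
        also have "(\<lambda>x. c * f x + (c * t) * k x) = (\<lambda>x. c * (f x + t * k x))"
          by (simp add: algebra_simps)
        also have "q \<dots> = c * q (\<lambda>x. f x + t * k x)"
          using that tk K by (intro qscale add scale) auto
        finally show "r (\<lambda>x. c * f x) / c \<le> q (\<lambda>x. f x + t * k x) - t * \<delta>"
          using that by (simp add: field_simps)
      qed
      then show ?thesis using that by (simp add: field_simps)
    qed
    have c: "0 < c" using False that by simp
    have "r (\<lambda>x. inverse c * (c * f x)) \<le> inverse c * r (\<lambda>x. c * f x)"
      using le[OF scale[OF that(1), of c], of "inverse c"] c by simp
    moreover have "(\<lambda>x. inverse c * (c * f x)) = f"
      using c by (simp add: fun_eq_iff)
    ultimately have "r f \<le> inverse c * r (\<lambda>x. c * f x)"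
      by simp
    then have "c * r f \<le> r (\<lambda>x. c * f x)"
      using c by (simp add: field_simps)
    with le[OF that(1) c] show ?thesis by simp
  qed
  ultimately have "sublinear_on V r"
    unfolding sublinear_on_def by blast
  moreover have "r (\<lambda>x. - k x) \<le> - \<delta>" if "k \<in> K" for k
    using r_le[of "\<lambda>x. - k x" 1 k] that K function_space_uminus[OF V, of k]
      sublinear_on_zero[OF V q] by auto
  ultimately show thesis
    using that r_le_q by blast
qed

text \<open>
  The Hahn-Banach theorem. Zorn's lemma provides a minimal sublinear functional \<open>q\<close> below \<open>p\<close>. Reducing
  \<open>q\<close> along a single \<open>f\<close> with \<open>\<delta> = q f\<close> cannot make it smaller, which gives \<open>q (- f) \<le> - q f\<close>;
  and an odd sublinear functional is linear.
\<close>

lemma linear_below_sublinear: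
  fixes V :: "('a \<Rightarrow> real) set"
  assumes V: "function_space V" and p: "sublinear_on V p"
  obtains \<phi> where "\<And>f g. f \<in> V \<Longrightarrow> g \<in> V \<Longrightarrow> \<phi> (\<lambda>x. f x + g x) = \<phi> f + \<phi> g"
    "\<And>c f. f \<in> V \<Longrightarrow> \<phi> (\<lambda>x. c * f x) = c * \<phi> f"
    "\<And>f. f \<in> V \<Longrightarrow> \<phi> f \<le> p f"
proof -
  \<comment> \<open>values outside \<open>V\<close> are fixed so that the pointwise order is antisymmetric\<close>
  define A where "A = {q. sublinear_on V q \<and> (\<forall>f\<in>V. q f \<le> p f) \<and> (\<forall>f. f \<notin> V \<longrightarrow> q f = 0)}"
  define P where "P = (\<lambda>q q' :: ('a \<Rightarrow> real) \<Rightarrow> real. q' \<le> q)"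
  have closed: "(\<lambda>_. 0) \<in> V" "\<And>f g. f \<in> V \<Longrightarrow> g \<in> V \<Longrightarrow> (\<lambda>x. f x + g x) \<in> V"
    "\<And>f c. f \<in> V \<Longrightarrow> (\<lambda>x. c * f x) \<in> V"
    using V unfolding function_space_def by auto
  have restrict: "(\<lambda>f. if f \<in> V then q f else 0) \<in> A"
    if "sublinear_on V q" "\<And>f. f \<in> V \<Longrightarrow> q f \<le> p f" for q
    using that closed unfolding A_def sublinear_on_def by auto
  have A_lower: "- p (\<lambda>x. - f x) \<le> q f" if "q \<in> A" "f \<in> V" for q f
    using sublinear_on_uminus[OF V, of q f] that function_space_uminus[OF V that(2)]
    unfolding A_def by fastforce
  have "\<exists>q\<in>A. \<forall>a\<in>A. P q a \<longrightarrow> a = q"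
  proof (rule predicate_Zorn)
    show "partial_order_on A (relation_of P A)"
      unfolding P_def
      by (intro partial_order_on_relation_ofI) auto
  next
    fix C assume C: "C \<in> Chains (relation_of P A)"
    then have CA: "C \<subseteq> A" by (auto simp: Chains_def relation_of_def)
    have total: "q \<le> q' \<or> q' \<le> q" if "q \<in> C" "q' \<in> C" for q q'
      using C that by (auto simp: Chains_def relation_of_def P_def)
    show "\<exists>u\<in>A. \<forall>a\<in>C. P a u"
    proof (cases "C = {}")
      case True
      then show ?thesis using restrict[OF p] by auto
    next
      case False
      define u where "u = (\<lambda>f. INF q\<in>C. q f)"
      have bdd: "bdd_below ((\<lambda>q. q f) ` C)" if "f \<in> V" for f
        using A_lower[OF _ that] CA by (intro bdd_belowI2[of _ "- p (\<lambda>x. - f x)"]) auto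
      have u_le: "u f \<le> q f" if "q \<in> C" "f \<in> V" for q f
        unfolding u_def using bdd that by (intro cINF_lower)
      have u_ge: "b \<le> u f" if "\<And>q. q \<in> C \<Longrightarrow> b \<le> q f" for b f
        unfolding u_def using False that by (intro cINF_greatest) auto
      have sub: "sublinear_on V q" if "q \<in> C" for q using CA that by (auto simp: A_def)
      have u_add: "u (\<lambda>x. f x + g x) \<le> u f + u g" if f: "f \<in> V" and g: "g \<in> V" for f g
      proof -
        have *: "u (\<lambda>x. f x + g x) \<le> q f + q' g" if q: "q \<in> C" "q' \<in> C" for q q'
        proof -
          obtain s where s: "s \<in> C" "s \<le> q" "s \<le> q'" using total[OF q] q by auto
          have "u (\<lambda>x. f x + g x) \<le> s (\<lambda>x. f x + g x)" using u_le s closed f g by blast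
          also have "\<dots> \<le> s f + s g" using sub[OF s(1)] f g by (auto simp: sublinear_on_def)
          also have "\<dots> \<le> q f + q' g" using s by (intro add_mono) (auto simp: le_fun_def)
          finally show ?thesis .
        qed
        have "u (\<lambda>x. f x + g x) - q' g \<le> u f" if "q' \<in> C" for q'
          by (rule u_ge) (use *[OF _ that] in \<open>smt (verit)\<close>)
        then have "u (\<lambda>x. f x + g x) - u f \<le> u g"
          by (intro u_ge) (smt (verit))
        then show ?thesis by simp
      qed
      have u_scale: "u (\<lambda>x. c * f x) = c * u f" if "f \<in> V" "0 \<le> c" for c f
      proof -
        have "u (\<lambda>x. c * f x) = (INF q\<in>C. c * q f)"
          unfolding u_def using sub that by (intro INF_cong) (auto simp: sublinear_on_def)
        also have "\<dots> = c * u f"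
        proof (cases "c = 0")
          case True then show ?thesis using False by simp
        next
          case c: False
          have "c * u f = Inf ((*) c ` (\<lambda>q. q f) ` C)"
            unfolding u_def using that c False bdd[OF that(1)]
            by (intro continuous_at_Inf_mono) (auto intro!: monoI mult_left_mono continuous_intros)
          then show ?thesis by (simp add: image_image)
        qed
        finally show ?thesis .
      qed
      have "sublinear_on V u" unfolding sublinear_on_def using u_add u_scale by blast
      moreover have "u f \<le> p f" if "f \<in> V" for f
        using False u_le[OF _ that] CA that by (fastforce simp: A_def)
      ultimately have "(\<lambda>f. if f \<in> V then u f else 0) \<in> A" by (rule restrict)
      moreover have "\<forall>a\<in>C. P a (\<lambda>f. if f \<in> V then u f else 0)"
        using CA u_le by (auto simp: P_def le_fun_def A_def)
      ultimately show ?thesis by blast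
    qed
  qed
  then obtain q where qA: "q \<in> A" and min: "\<And>a. a \<in> A \<Longrightarrow> a \<le> q \<Longrightarrow> a = q"
    unfolding P_def by blast
  have q: "sublinear_on V q" "\<And>f. f \<in> V \<Longrightarrow> q f \<le> p f" using qA by (auto simp: A_def)
  have odd: "q (\<lambda>x. - f x) = - q f" if f: "f \<in> V" for f
  proof -
    have cf: "convex_functions {f}"
      unfolding convex_functions_def by (auto simp: fun_eq_iff algebra_simps)
    obtain r where r: "sublinear_on V r" "\<And>h. h \<in> V \<Longrightarrow> r h \<le> q h" "r (\<lambda>x. - f x) \<le> - q f"
      using sublinear_on_reduction[OF V q(1), of "{f}" "q f"] f cf by auto
    have "(\<lambda>h. if h \<in> V then r h else 0) = q"
    proof (rule min)
      show "(\<lambda>h. if h \<in> V then r h else 0) \<in> A"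
        using r q by (intro restrict) (auto intro: order_trans)
      show "(\<lambda>h. if h \<in> V then r h else 0) \<le> q"
        using r qA by (auto simp: le_fun_def A_def)
    qed
    then have "r (\<lambda>x. - f x) = q (\<lambda>x. - f x)"
      using function_space_uminus[OF V f] by (drule_tac fun_cong[of _ _ "\<lambda>x. - f x"]) simp
    then have "q (\<lambda>x. - f x) \<le> - q f"
      using r(3) by simp
    moreover have "- q f \<le> q (\<lambda>x. - f x)"
      using sublinear_on_uminus[OF V q(1) f] by simp
    ultimately show ?thesis by simp
  qed
  show thesis
  proof
    fix f g assume f: "f \<in> V" and g: "g \<in> V"
    have "q (\<lambda>x. (f x + g x) + - g x) \<le> q (\<lambda>x. f x + g x) + q (\<lambda>x. - g x)"
      by (rule sublinear_on_add[OF q(1) closed(2)[OF f g] function_space_uminus[OF V g]])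
    moreover have "q (\<lambda>x. f x + g x) \<le> q f + q g"
      by (rule sublinear_on_add[OF q(1) f g])
    ultimately show "q (\<lambda>x. f x + g x) = q f + q g"
      using odd[OF g] by simp
  next
    fix c f assume f: "f \<in> V"
    show "q (\<lambda>x. c * f x) = c * q f"
    proof (cases "0 \<le> c")
      case True
      then show ?thesis by (rule sublinear_on_scale[OF q(1) f])
    next
      case False
      have "q (\<lambda>x. - ((- c) * f x)) = - q (\<lambda>x. (- c) * f x)" using odd closed(3)[OF f] by blast
      also have "q (\<lambda>x. (- c) * f x) = (- c) * q f"
      proof -
        have "0 \<le> - c" using False by simp
        then show ?thesis by (rule sublinear_on_scale[OF q(1) f])
      qed
      finally show ?thesis by simp
    qed
  qed (use q in auto)
qed

text \<open>
  A linear functional below the reduced functional satisfies \<open>\<phi> (- k) \<le> - \<delta>\<close> on \<open>K\<close>, which is the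
  required lower bound.
\<close>

theorem mazur_orlicz:
  fixes V :: "('a \<Rightarrow> real) set"
  assumes V: "function_space V" and p: "sublinear_on V p"
    and K: "K \<subseteq> V" "K \<noteq> {}" "convex_functions K" and \<delta>: "\<And>k. k \<in> K \<Longrightarrow> \<delta> \<le> p k"
  obtains \<phi> where "\<And>f g. f \<in> V \<Longrightarrow> g \<in> V \<Longrightarrow> \<phi> (\<lambda>x. f x + g x) = \<phi> f + \<phi> g"
    "\<And>c f. f \<in> V \<Longrightarrow> \<phi> (\<lambda>x. c * f x) = c * \<phi> f"
    "\<And>f. f \<in> V \<Longrightarrow> \<phi> f \<le> p f"
    "\<And>k. k \<in> K \<Longrightarrow> \<delta> \<le> \<phi> k"
proof -
  obtain r where r: "sublinear_on V r" "\<And>f. f \<in> V \<Longrightarrow> r f \<le> p f"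
    "\<And>k. k \<in> K \<Longrightarrow> r (\<lambda>x. - k x) \<le> - \<delta>"
    using sublinear_on_reduction[OF assms] by blast
  show thesis
  proof (rule linear_below_sublinear[OF V r(1)])
    fix \<phi> assume \<phi>: "\<And>f g. f \<in> V \<Longrightarrow> g \<in> V \<Longrightarrow> \<phi> (\<lambda>x. f x + g x) = \<phi> f + \<phi> g"
      "\<And>c f. f \<in> V \<Longrightarrow> \<phi> (\<lambda>x. c * f x) = c * \<phi> f" "\<And>f. f \<in> V \<Longrightarrow> \<phi> f \<le> r f"
    show thesis
    proof (rule that[OF \<phi>(1,2)])
      fix f assume "f \<in> V"
      then show "\<phi> f \<le> p f" using \<phi>(3) r(2) order_trans by blast
    next
      fix k assume k: "k \<in> K"
      then have kV: "k \<in> V" using K(1) by blast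
      have "\<phi> (\<lambda>x. - k x) = - \<phi> k"
        using \<phi>(2)[OF kV, of "-1"] by simp
      moreover have "\<phi> (\<lambda>x. - k x) \<le> - \<delta>"
        using \<phi>(3)[OF function_space_uminus[OF V kV]] r(3)[OF k] by simp
      ultimately show "\<delta> \<le> \<phi> k" by simp
    qed
  qed
qed

section \<open>The $L^p$ seminorm\<close>

lemma powr_convex_nonneg:
  fixes a b t p :: real
  assumes p: "1 \<le> p" and ab: "0 \<le> a" "0 \<le> b" and t: "0 \<le> t" "t \<le> 1"
  shows "(t * a + (1 - t) * b) powr p \<le> t * a powr p + (1 - t) * b powr p"
proof -
  have small: "(s * c) powr p \<le> s * c powr p" if "0 \<le> s" "s \<le> 1" "0 \<le> c" for s c :: real
  proof -
    have "s powr p \<le> s"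
      using that p powr_mono'[of 1 p s] by (cases "s = 0") auto
    then show ?thesis
      using that by (simp add: powr_mult mult_right_mono)
  qed
  consider "a = 0" | "b = 0" | "0 < a" "0 < b" using ab by force
  then show ?thesis
  proof cases
    case 1 then show ?thesis using small[of "1 - t" b] t ab p by simp
  next
    case 2 then show ?thesis using small[of t a] t ab p by simp
  next
    case 3
    then show ?thesis
      using convex_onD[OF powr_convex[OF p], of "1 - t" a b] t by simp
  qed
qed

lemma LpD:
  assumes "f \<in> Lp m p"
  shows "f \<in> borel_measurable m" "integrable m (\<lambda>x. \<bar>f x\<bar> powr p)"
  using assms by (auto simp: Lp_def)

lemma Lp_function_space:
  assumes "1 \<le> p"
  shows "function_space (Lp m p)"
  unfolding function_space_def
proof (intro conjI ballI allI)
  show "(\<lambda>_. 0) \<in> Lp m p" by (simp add: Lp_def)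
next
  fix f g assume f: "f \<in> Lp m p" and g: "g \<in> Lp m p"
  note [measurable] = LpD(1)[OF f] LpD(1)[OF g]
  have "integrable m (\<lambda>x. \<bar>f x + g x\<bar> powr p)"
  proof (rule Bochner_Integration.integrable_bound)
    show "integrable m (\<lambda>x. 2 powr p * (\<bar>f x\<bar> powr p + \<bar>g x\<bar> powr p))"
      using LpD(2)[OF f] LpD(2)[OF g] by simp
    have "\<bar>a + b\<bar> powr p \<le> 2 powr p * (\<bar>a\<bar> powr p + \<bar>b\<bar> powr p)" for a b :: real
    proof -
      have "\<bar>a + b\<bar> powr p \<le> (2 * ((1/2) * \<bar>a\<bar> + (1 - 1/2) * \<bar>b\<bar>)) powr p"
        using assms by (intro powr_mono2) auto
      also have "\<dots> = 2 powr p * ((1/2) * \<bar>a\<bar> + (1 - 1/2) * \<bar>b\<bar>) powr p"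
        by (subst powr_mult) auto
      also have "\<dots> \<le> 2 powr p * ((1/2) * \<bar>a\<bar> powr p + (1 - 1/2) * \<bar>b\<bar> powr p)"
        using powr_convex_nonneg[OF assms, of "\<bar>a\<bar>" "\<bar>b\<bar>" "1/2"] by (intro mult_left_mono) auto
      also have "\<dots> \<le> 2 powr p * (\<bar>a\<bar> powr p + \<bar>b\<bar> powr p)"
        by (intro mult_left_mono) (auto intro!: add_mono)
      finally show ?thesis .
    qed
    then show "AE x in m. norm (\<bar>f x + g x\<bar> powr p)
        \<le> norm (2 powr p * (\<bar>f x\<bar> powr p + \<bar>g x\<bar> powr p))"
      by simp
  qed simp
  then show "(\<lambda>x. f x + g x) \<in> Lp m p" by (simp add: Lp_def)
next
  fix c f assume f: "f \<in> Lp m p"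
  show "(\<lambda>x. c * f x) \<in> Lp m p"
    using LpD[OF f] by (simp add: Lp_def abs_mult powr_mult)
qed

lemma Lp_diff: "1 \<le> p \<Longrightarrow> f \<in> Lp m p \<Longrightarrow> g \<in> Lp m p \<Longrightarrow> (\<lambda>x. f x - g x) \<in> Lp m p"
  using function_space_add[OF Lp_function_space, of p f m "\<lambda>x. - g x"]
    function_space_uminus[OF Lp_function_space, of p g m] by simp

lemma Lp_norm_nonneg: "0 \<le> Lp_norm m p f"
  by (simp add: Lp_norm_def)

lemma Lp_norm_powr:
  assumes "1 \<le> p"
  shows "Lp_norm m p f powr p = (LINT x|m. \<bar>f x\<bar> powr p)"
  using assms by (simp add: Lp_norm_def powr_powr integral_nonneg)

lemma Lp_norm_le_iff:
  assumes "1 \<le> p" "0 \<le> e"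
  shows "Lp_norm m p f \<le> e \<longleftrightarrow> (LINT x|m. \<bar>f x\<bar> powr p) \<le> e powr p"
  unfolding Lp_norm_powr[OF assms(1), of m f, symmetric]
  using assms Lp_norm_nonneg[of m p f] powr_less_mono2[of p e "Lp_norm m p f"]
    powr_mono2[of p "Lp_norm m p f" e] by fastforce

text \<open>
  Minkowski's inequality is convexity of \<open>t powr p\<close> applied to \<open>f\<close> and \<open>g\<close> divided by their norms.
  An additional \<open>e / 2\<close> keeps both denominators positive when a norm vanishes.
\<close>

lemma Lp_norm_triangle:
  assumes p: "1 \<le> p" and f: "f \<in> Lp m p" and g: "g \<in> Lp m p"
  shows "Lp_norm m p (\<lambda>x. f x + g x) \<le> Lp_norm m p f + Lp_norm m p g"
proof (rule field_le_epsilon)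
  fix e :: real assume e: "0 < e"
  define a where "a = Lp_norm m p f + e/2"
  define b where "b = Lp_norm m p g + e/2"
  have ab: "0 < a" "0 < b" "0 < a + b"
    using e Lp_norm_nonneg[of m p f] Lp_norm_nonneg[of m p g] by (auto simp: a_def b_def)
  have ratio: "1 - a / (a + b) = b / (a + b)" using ab by (simp add: field_simps)
  note fg = function_space_add[OF Lp_function_space[OF p] f g]
  have ptw: "\<bar>u + v\<bar> powr p
      \<le> (a + b) powr p * (a / (a + b) * (\<bar>u\<bar> powr p / a powr p) + b / (a + b) * (\<bar>v\<bar> powr p / b powr p))"
    for u v :: real
  proof -
    have "\<bar>u + v\<bar> powr p \<le> (\<bar>u\<bar> + \<bar>v\<bar>) powr p"
      using p by (intro powr_mono2) auto
    also have "\<bar>u\<bar> + \<bar>v\<bar> = (a + b) * (a / (a + b) * (\<bar>u\<bar> / a) + (1 - a / (a + b)) * (\<bar>v\<bar> / b))"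
      unfolding ratio using ab by (simp add: distrib_left)
    also have "\<dots> powr p
        = (a + b) powr p * (a / (a + b) * (\<bar>u\<bar> / a) + (1 - a / (a + b)) * (\<bar>v\<bar> / b)) powr p"
      by (rule powr_mult)
    also have "\<dots> \<le> (a + b) powr p
        * (a / (a + b) * (\<bar>u\<bar> / a) powr p + (1 - a / (a + b)) * (\<bar>v\<bar> / b) powr p)"
      using ab by (intro mult_left_mono powr_convex_nonneg p) auto
    finally show ?thesis unfolding ratio using ab by (simp add: powr_divide)
  qed
  have If: "(LINT x|m. \<bar>f x\<bar> powr p) \<le> a powr p"
    using Lp_norm_le_iff[OF p, of a m f] ab e by (simp add: a_def)
  have Ig: "(LINT x|m. \<bar>g x\<bar> powr p) \<le> b powr p"
    using Lp_norm_le_iff[OF p, of b m g] ab e by (simp add: b_def)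
  have "(LINT x|m. \<bar>f x + g x\<bar> powr p) \<le> (LINT x|m. (a + b) powr p
      * (a / (a + b) * (\<bar>f x\<bar> powr p / a powr p) + b / (a + b) * (\<bar>g x\<bar> powr p / b powr p)))"
    using LpD(2)[OF f] LpD(2)[OF g] LpD(2)[OF fg] ptw by (intro integral_mono) auto
  also have "\<dots> = (a + b) powr p * (a / (a + b) * ((LINT x|m. \<bar>f x\<bar> powr p) / a powr p)
      + b / (a + b) * ((LINT x|m. \<bar>g x\<bar> powr p) / b powr p))"
    using LpD(2)[OF f] LpD(2)[OF g] by simp
  also have "\<dots> \<le> (a + b) powr p * (a / (a + b) * 1 + b / (a + b) * 1)"
    using If Ig ab by (intro mult_left_mono add_mono) auto
  also have "\<dots> = (a + b) powr p"
    using ab by (simp add: add_divide_distrib[symmetric])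
  finally have "Lp_norm m p (\<lambda>x. f x + g x) \<le> a + b"
    using Lp_norm_le_iff[OF p, of "a + b" m] ab by simp
  then show "Lp_norm m p (\<lambda>x. f x + g x) \<le> Lp_norm m p f + Lp_norm m p g + e"
    by (simp add: a_def b_def)
qed

lemma Lp_norm_scale:
  assumes "1 \<le> p"
  shows "Lp_norm m p (\<lambda>x. c * f x) = \<bar>c\<bar> * Lp_norm m p f"
  using assms by (simp add: Lp_norm_def abs_mult powr_mult powr_powr)

lemma sublinear_on_Lp_norm: "1 \<le> p \<Longrightarrow> sublinear_on (Lp m p) (Lp_norm m p)"
  by (simp add: sublinear_on_def Lp_norm_triangle Lp_norm_scale)

lemma Lp_norm_diff_triangle:
  assumes p: "1 \<le> p" and "f \<in> Lp m p" "g \<in> Lp m p" "h \<in> Lp m p"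
  shows "Lp_norm m p (\<lambda>x. f x - h x) \<le> Lp_norm m p (\<lambda>x. f x - g x) + Lp_norm m p (\<lambda>x. g x - h x)"
  using Lp_norm_triangle[OF p Lp_diff[OF p assms(2,3)] Lp_diff[OF p assms(3,4)]] by simp

text \<open>
  The Mazur-Orlicz theorem for the convex set \<open>K - f\<close>, on which the norm is at least \<open>\<delta>\<close>.
  This takes the place of Mazur's lemma: a weak limit of elements of \<open>K\<close> cannot have
  positive distance from \<open>K\<close>.
\<close>

lemma convex_at_distance_separated:
  assumes p: "1 \<le> p" and K: "K \<subseteq> Lp m p" "K \<noteq> {}" "convex_functions K" and f: "f \<in> Lp m p"
    and dist: "\<And>k. k \<in> K \<Longrightarrow> \<delta> \<le> Lp_norm m p (\<lambda>x. k x - f x)"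
  obtains \<phi> where "\<phi> \<in> Lp_dual m p" "\<And>h. h \<in> Lp m p \<Longrightarrow> \<phi> h \<le> Lp_norm m p h"
    "\<And>k. k \<in> K \<Longrightarrow> \<phi> f + \<delta> \<le> \<phi> k"
proof -
  note V = Lp_function_space[OF p, of m]
  have 1: "(\<lambda>k x. k x - f x) ` K \<subseteq> Lp m p"
    using K(1) Lp_diff[OF p _ f] by blast
  have 2: "(\<lambda>k x. k x - f x) ` K \<noteq> {}" using K(2) by simp
  have 3: "convex_functions ((\<lambda>k x. k x - f x) ` K)"
    unfolding convex_functions_def
  proof (intro ballI)
    fix g h and t :: real
    assume "g \<in> (\<lambda>k x. k x - f x) ` K" "h \<in> (\<lambda>k x. k x - f x) ` K" and t: "t \<in> {0..1}"
    then obtain k l where kl: "k \<in> K" "l \<in> K" "g = (\<lambda>x. k x - f x)" "h = (\<lambda>x. l x - f x)"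
      by auto
    have "(\<lambda>x. t * k x + (1 - t) * l x) \<in> K"
      using K(3) kl t unfolding convex_functions_def by blast
    moreover have "(\<lambda>x. t * g x + (1 - t) * h x) = (\<lambda>x. (t * k x + (1 - t) * l x) - f x)"
      by (simp add: kl algebra_simps)
    ultimately show "(\<lambda>x. t * g x + (1 - t) * h x) \<in> (\<lambda>k x. k x - f x) ` K"
      by (intro image_eqI[where x = "\<lambda>x. t * k x + (1 - t) * l x"])
  qed
  have 4: "\<delta> \<le> Lp_norm m p k" if "k \<in> (\<lambda>k x. k x - f x) ` K" for k
    using that dist by auto
  show thesis
  proof (rule mazur_orlicz[OF V sublinear_on_Lp_norm[OF p] 1 2 3 4])
    fix \<phi> assume \<phi>: "\<And>f g. f \<in> Lp m p \<Longrightarrow> g \<in> Lp m p \<Longrightarrow> \<phi> (\<lambda>x. f x + g x) = \<phi> f + \<phi> g"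
      "\<And>c f. f \<in> Lp m p \<Longrightarrow> \<phi> (\<lambda>x. c * f x) = c * \<phi> f"
      "\<And>f. f \<in> Lp m p \<Longrightarrow> \<phi> f \<le> Lp_norm m p f"
      "\<And>k. k \<in> (\<lambda>k x. k x - f x) ` K \<Longrightarrow> \<delta> \<le> \<phi> k"
    have bound: "\<bar>\<phi> h\<bar> \<le> 1 * Lp_norm m p h" if h: "h \<in> Lp m p" for h
    proof -
      have "- \<phi> h = \<phi> (\<lambda>x. - h x)" using \<phi>(2)[OF h, of "-1"] by simp
      also have "\<dots> \<le> Lp_norm m p h"
        using \<phi>(3)[OF function_space_uminus[OF V h]] by (simp add: Lp_norm_def)
      finally show ?thesis using \<phi>(3)[OF h] by simp
    qed
    show thesis
    proof (rule that)
      show "\<phi> \<in> Lp_dual m p"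
        unfolding Lp_dual_def mem_Collect_eq using \<phi>(1,2) bound by blast
    next
      fix k assume k: "k \<in> K"
      then have kL: "k \<in> Lp m p" using K(1) by blast
      have "\<phi> (\<lambda>x. f x + (k x - f x)) = \<phi> f + \<phi> (\<lambda>x. k x - f x)"
        by (rule \<phi>(1)[OF f Lp_diff[OF p kL f]])
      then show "\<phi> f + \<delta> \<le> \<phi> k" using \<phi>(4)[of "\<lambda>x. k x - f x"] k by simp
    qed (use \<phi>(3) in blast)
  qed
qed

lemma Lp_norm_tendsto_zeroI:
  assumes p: "0 < p" and lim: "(\<lambda>n. LINT x|m. \<bar>f n x\<bar> powr p) \<longlonglongrightarrow> 0"
  shows "(\<lambda>n. Lp_norm m p (f n)) \<longlonglongrightarrow> 0"
  unfolding Lp_norm_def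
  by (rule tendsto_zero_powrI[OF lim tendsto_const]) (use p in \<open>auto intro!: integral_nonneg\<close>)

lemma nn_integral_powr_on_finite_tendsto:
  fixes h :: "nat \<Rightarrow> 'a \<Rightarrow> real"
  assumes p: "0 < p" and S: "S \<in> sets m" "emeasure m S < \<infinity>"
    and [measurable]: "\<And>n. h n \<in> borel_measurable m" "g \<in> borel_measurable m"
    and h: "\<And>n x. x \<in> S \<Longrightarrow> 0 \<le> h n x" "\<And>n x. x \<in> S \<Longrightarrow> h n x \<le> C"
    and lim: "\<And>x. x \<in> S \<Longrightarrow> (\<lambda>n. h n x) \<longlonglongrightarrow> g x"
  shows "(\<lambda>n. \<integral>\<^sup>+x. ennreal (h n x powr p) * indicator S x \<partial>m)
    \<longlonglongrightarrow> (\<integral>\<^sup>+x. ennreal (g x powr p) * indicator S x \<partial>m)"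
proof (rule nn_integral_dominated_convergence[where w = "\<lambda>x. ennreal (C powr p) * indicator S x"])
  note [measurable] = S(1)
  show "(\<lambda>x. ennreal (h n x powr p) * indicator S x) \<in> borel_measurable m" for n by simp
  show "(\<lambda>x. ennreal (g x powr p) * indicator S x) \<in> borel_measurable m" by simp
  show "(\<lambda>x. ennreal (C powr p) * indicator S x) \<in> borel_measurable m" by simp
  show "(\<integral>\<^sup>+x. ennreal (C powr p) * indicator S x \<partial>m) < \<infinity>"
    using S by (simp add: nn_integral_cmult_indicator ennreal_mult_less_top)
  show "AE x in m. ennreal (h n x powr p) * indicator S x \<le> ennreal (C powr p) * indicator S x" for n
    using h p by (intro always_eventually allI) (auto split: split_indicator intro!: ennreal_leI powr_mono2)
  have "(\<lambda>n. ennreal (h n x powr p) * indicator S x) \<longlonglongrightarrow> ennreal (g x powr p) * indicator S x" for x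
  proof (cases "x \<in> S")
    case True
    have "(\<lambda>n. h n x powr p) \<longlonglongrightarrow> g x powr p"
      using p h(1)[OF True] by (intro tendsto_powr2[OF lim[OF True] tendsto_const]) auto
    then show ?thesis using True by (auto intro!: tendsto_ennrealI)
  qed simp
  then show "AE x in m. (\<lambda>n. ennreal (h n x powr p) * indicator S x)
      \<longlonglongrightarrow> ennreal (g x powr p) * indicator S x"
    by simp
qed

section \<open>Lipschitz constants and asymptotic slopes\<close>

context Metric_space
begin

lemma LIP_iff: "f \<in> LIP \<longleftrightarrow> (\<exists>L>0. \<forall>x\<in>M. \<forall>y\<in>M. \<bar>f x - f y\<bar> \<le> L * d x y)"
  by (simp add: LIP_def Lipschitz_continuous_map_pos dist_real_def)

lemma LIPI:
  assumes "\<And>x y. x \<in> M \<Longrightarrow> y \<in> M \<Longrightarrow> \<bar>f x - f y\<bar> \<le> L * d x y"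
  shows "f \<in> LIP"
proof -
  have "\<bar>f x - f y\<bar> \<le> (\<bar>L\<bar> + 1) * d x y" if "x \<in> M" "y \<in> M" for x y
    using assms[OF that] by (smt (verit) mult_right_mono nonneg)
  then show ?thesis unfolding LIP_iff by (intro exI[of _ "\<bar>L\<bar> + 1"]) auto
qed

lemma boundedly_supported_iff: "boundedly_supported f \<longleftrightarrow> mbounded {x \<in> M. f x \<noteq> 0}"
  unfolding boundedly_supported_def by (rule mbounded_closure_of_eq) auto

lemma boundedly_supported_iff_ball:
  assumes "x \<in> M"
  shows "boundedly_supported f \<longleftrightarrow> (\<exists>R>0. \<forall>y\<in>M. f y \<noteq> 0 \<longrightarrow> d x y < R)"
proof
  assume "boundedly_supported f"
  then obtain z B where "{x \<in> M. f x \<noteq> 0} \<subseteq> mcball z B"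
    unfolding boundedly_supported_iff mbounded_def by blast
  then have "d x y < d x z + \<bar>B\<bar> + 1" if "y \<in> M" "f y \<noteq> 0" for y
    using that assms triangle[of x z y] by (fastforce simp: in_mcball)
  moreover have "d x z + \<bar>B\<bar> + 1 > 0" using nonneg[of x z] by linarith
  ultimately show "\<exists>R>0. \<forall>y\<in>M. f y \<noteq> 0 \<longrightarrow> d x y < R" by blast
next
  assume "\<exists>R>0. \<forall>y\<in>M. f y \<noteq> 0 \<longrightarrow> d x y < R"
  then obtain R where "\<forall>y\<in>M. f y \<noteq> 0 \<longrightarrow> d x y < R" by blast
  then have "{x \<in> M. f x \<noteq> 0} \<subseteq> mball x R" using assms by auto
  then show "boundedly_supported f"
    unfolding boundedly_supported_iff using mbounded_mball mbounded_subset by blast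
qed

lemma LIP_quotients_bdd_above:
  assumes "f \<in> LIP" "E \<subseteq> M"
  shows "bdd_above {\<bar>f x - f y\<bar> / d x y | x y. x \<in> E \<and> y \<in> E \<and> x \<noteq> y}"
proof -
  obtain L where L: "\<And>x y. x \<in> M \<Longrightarrow> y \<in> M \<Longrightarrow> \<bar>f x - f y\<bar> \<le> L * d x y"
    using assms(1) unfolding LIP_iff by blast
  show ?thesis
  proof (rule bdd_aboveI)
    fix v assume "v \<in> {\<bar>f x - f y\<bar> / d x y | x y. x \<in> E \<and> y \<in> E \<and> x \<noteq> y}"
    then obtain x y where xy: "v = \<bar>f x - f y\<bar> / d x y" "x \<in> M" "y \<in> M" "x \<noteq> y"
      using assms(2) by blast
    then have "d x y > 0" by simp
    then show "v \<le> L" using L[OF xy(2,3)] xy(1) by (simp add: pos_divide_le_eq)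
  qed
qed

lemma Lip_const_bound:
  assumes "f \<in> LIP" "E \<subseteq> M" "x \<in> E" "y \<in> E"
  shows "\<bar>f x - f y\<bar> \<le> Lip_const f E * d x y"
proof (cases "x = y")
  case True
  then show ?thesis using assms by auto
next
  case False
  have xy: "x \<in> M" "y \<in> M" using assms by auto
  have "\<bar>f x - f y\<bar> / d x y \<le> Lip_const f E"
    unfolding Lip_const_def using assms False
    by (auto intro!: cSup_upper LIP_quotients_bdd_above)
  then show ?thesis
    using False xy by (simp add: pos_divide_le_eq)
qed

lemma Lip_const_le:
  assumes "0 \<le> c" "E \<subseteq> M" "\<And>x y. x \<in> E \<Longrightarrow> y \<in> E \<Longrightarrow> \<bar>f x - f y\<bar> \<le> c * d x y"
  shows "Lip_const f E \<le> c"
proof (cases "\<exists>x\<in>E. \<exists>y\<in>E. x \<noteq> y")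
  case True
  have "Sup {\<bar>f x - f y\<bar> / d x y | x y. x \<in> E \<and> y \<in> E \<and> x \<noteq> y} \<le> c"
  proof (rule cSup_least)
    show "{\<bar>f x - f y\<bar> / d x y | x y. x \<in> E \<and> y \<in> E \<and> x \<noteq> y} \<noteq> {}" using True by blast
  next
    fix v assume "v \<in> {\<bar>f x - f y\<bar> / d x y | x y. x \<in> E \<and> y \<in> E \<and> x \<noteq> y}"
    then obtain x y where xy: "v = \<bar>f x - f y\<bar> / d x y" "x \<in> E" "y \<in> E" "x \<noteq> y" by blast
    then have "d x y > 0" using assms(2) by (simp add: subset_iff)
    then show "v \<le> c" using assms(3)[OF xy(2,3)] xy(1) by (simp add: pos_divide_le_eq)
  qed
  then show ?thesis using True by (simp add: Lip_const_def)
next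
  case False
  then show ?thesis using assms(1) by (auto simp: Lip_const_def)
qed

lemma Lip_const_nonneg:
  assumes "f \<in> LIP" "E \<subseteq> M"
  shows "0 \<le> Lip_const f E"
proof (cases "\<exists>x\<in>E. \<exists>y\<in>E. x \<noteq> y")
  case True
  then obtain x y where xy: "x \<in> E" "y \<in> E" "x \<noteq> y" by blast
  then have "d x y > 0" using assms(2) by (simp add: subset_iff)
  moreover have "0 \<le> Lip_const f E * d x y"
    using Lip_const_bound[OF assms xy(1,2)] by linarith
  ultimately show ?thesis by (simp add: zero_le_mult_iff)
qed (auto simp: Lip_const_def)

lemma Lip_const_mono:
  assumes "f \<in> LIP" "E \<subseteq> F" "F \<subseteq> M"
  shows "Lip_const f E \<le> Lip_const f F"
  using assms by (intro Lip_const_le Lip_const_nonneg Lip_const_bound) auto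

lemma asymptotic_slope_le_Lip_const:
  assumes "f \<in> LIP" "0 < r"
  shows "asymptotic_slope f x \<le> Lip_const f (mball x r)"
  unfolding asymptotic_slope_def
  by (rule cINF_lower) (use assms Lip_const_nonneg[OF assms(1) mball_subset_mspace] in \<open>auto intro!: bdd_belowI2[of _ 0]\<close>)

lemma asymptotic_slope_le:
  assumes "f \<in> LIP" "0 < r" "0 \<le> c"
    and "\<And>y z. y \<in> mball x r \<Longrightarrow> z \<in> mball x r \<Longrightarrow> \<bar>f y - f z\<bar> \<le> c * d y z"
  shows "asymptotic_slope f x \<le> c"
  using asymptotic_slope_le_Lip_const[OF assms(1,2), of x] Lip_const_le[OF assms(3) _ assms(4), of "mball x r"]
  by fastforce

lemma asymptotic_slope_lessE:
  assumes "asymptotic_slope f x < c"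
  obtains r where "0 < r" "Lip_const f (mball x r) < c"
proof -
  have "\<exists>v\<in>(\<lambda>r. Lip_const f (mball x r)) ` {0<..}. v < c"
    by (rule cInf_lessD) (use assms in \<open>auto simp: asymptotic_slope_def\<close>)
  then show thesis using that by auto
qed

lemma asymptotic_slope_nonneg:
  assumes "f \<in> LIP"
  shows "0 \<le> asymptotic_slope f x"
  unfolding asymptotic_slope_def using Lip_const_nonneg[OF assms mball_subset_mspace] by (intro cINF_greatest) auto

lemma asymptotic_slope_local:
  assumes "f \<in> LIP" "asymptotic_slope f x < c"
  obtains r where "0 < r"
    "\<And>y z. y \<in> mball x r \<Longrightarrow> z \<in> mball x r \<Longrightarrow> \<bar>f y - f z\<bar> \<le> c * d y z"
proof -
  obtain r where r: "0 < r" "Lip_const f (mball x r) < c"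
    using asymptotic_slope_lessE[OF assms(2)] .
  have "\<bar>f y - f z\<bar> \<le> c * d y z" if "y \<in> mball x r" "z \<in> mball x r" for y z
  proof -
    have "\<bar>f y - f z\<bar> \<le> Lip_const f (mball x r) * d y z"
      using Lip_const_bound[OF assms(1) mball_subset_mspace that] .
    also have "\<dots> \<le> c * d y z" using r by (intro mult_right_mono) auto
    finally show ?thesis .
  qed
  then show thesis using that r by blast
qed

lemma asymptotic_slope_leI:
  assumes "f \<in> LIP"
    and "\<And>c'. c < c' \<Longrightarrow>
      \<exists>r>0. \<forall>y\<in>mball x r. \<forall>z\<in>mball x r. \<bar>f y - f z\<bar> \<le> c' * d y z"
    and "0 \<le> c"
  shows "asymptotic_slope f x \<le> c"
proof (rule dense_ge)
  fix c' assume "c < c'"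
  then obtain r where "0 < r" "\<forall>y\<in>mball x r. \<forall>z\<in>mball x r. \<bar>f y - f z\<bar> \<le> c' * d y z"
    using assms(2) by blast
  then show "asymptotic_slope f x \<le> c'"
    using assms(1,3) \<open>c < c'\<close> by (intro asymptotic_slope_le[of f r]) auto
qed

text \<open>
  The link between the two scales of the recovery construction, which controls slopes only by
  Lipschitz constants on balls of a fixed radius.
\<close>

lemma Lip_const_ball_tendsto_asymptotic_slope:
  assumes "f \<in> LIP" and r: "\<And>n. 0 < r n" "r \<longlonglongrightarrow> 0"
  shows "(\<lambda>n. Lip_const f (mball x (r n))) \<longlonglongrightarrow> asymptotic_slope f x"
proof (rule order_tendstoI)
  fix a assume "a < asymptotic_slope f x"
  then show "\<forall>\<^sub>F n in sequentially. a < Lip_const f (mball x (r n))"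
    using asymptotic_slope_le_Lip_const[OF assms(1) r(1)]
    by (intro always_eventually allI) (meson less_le_trans)
next
  fix a assume "asymptotic_slope f x < a"
  then obtain s where s: "0 < s" "Lip_const f (mball x s) < a"
    by (rule asymptotic_slope_lessE)
  have "\<forall>\<^sub>F n in sequentially. r n < s" using r(2) s(1) by (rule order_tendstoD)
  then show "\<forall>\<^sub>F n in sequentially. Lip_const f (mball x (r n)) < a"
  proof eventually_elim
    case (elim n)
    have "Lip_const f (mball x (r n)) \<le> Lip_const f (mball x s)"
      using elim by (intro Lip_const_mono[OF assms(1)] mball_subset_concentric) auto
    then show ?case using s by simp
  qed
qed

text \<open>
  The asymptotic slope is upper semicontinuous, and the Lipschitz constant on balls of fixed radius is
  lower semicontinuous in the centre. Both are therefore Borel, without which their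
  integrals need not be additive.
\<close>

lemma openin_asymptotic_slope_less:
  assumes "f \<in> LIP"
  shows "openin mtopology {x \<in> M. asymptotic_slope f x < c}"
  unfolding openin_mtopology
proof (intro conjI allI impI)
  fix x assume "x \<in> {x \<in> M. asymptotic_slope f x < c}"
  then have x: "x \<in> M" "asymptotic_slope f x < c" by auto
  obtain r where r: "0 < r" "Lip_const f (mball x r) < c"
    using asymptotic_slope_lessE[OF x(2)] .
  have "y \<in> {x \<in> M. asymptotic_slope f x < c}" if y: "y \<in> mball x r" for y
  proof -
    obtain s where s: "s > 0" "mball y s \<subseteq> mball x r"
      using y openin_mball[of x r] unfolding openin_mtopology by blast
    have "asymptotic_slope f y \<le> Lip_const f (mball y s)"
      by (rule asymptotic_slope_le_Lip_const[OF assms s(1)])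
    also have "\<dots> \<le> Lip_const f (mball x r)"
      by (rule Lip_const_mono[OF assms s(2)]) auto
    finally show ?thesis using r y by auto
  qed
  then show "\<exists>r>0. mball x r \<subseteq> {x \<in> M. asymptotic_slope f x < c}" using r by blast
qed auto

lemma openin_Lip_const_ball_greater:
  assumes "f \<in> LIP"
  shows "openin mtopology {x \<in> M. c < Lip_const f (mball x r)}"
  unfolding openin_mtopology
proof (intro conjI allI impI)
  fix x assume "x \<in> {x \<in> M. c < Lip_const f (mball x r)}"
  then have x: "x \<in> M" "c < Lip_const f (mball x r)" by auto
  show "\<exists>s>0. mball x s \<subseteq> {x \<in> M. c < Lip_const f (mball x r)}"
  proof (cases "c < 0")
    case True
    have "0 \<le> Lip_const f (mball y r)" for y by (rule Lip_const_nonneg[OF assms]) auto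
    then have "c < Lip_const f (mball y r)" for y using True by (meson less_le_trans)
    then show ?thesis by (intro exI[of _ 1]) auto
  next
    case False
    have "\<exists>y\<in>mball x r. \<exists>z\<in>mball x r. \<not> \<bar>f y - f z\<bar> \<le> c * d y z"
    proof (rule ccontr)
      assume "\<not> ?thesis"
      then have "Lip_const f (mball x r) \<le> c"
        using False by (intro Lip_const_le) auto
      then show False using x by simp
    qed
    then obtain y z where yz: "y \<in> mball x r" "z \<in> mball x r" "c * d y z < \<bar>f y - f z\<bar>"
      by (auto simp: not_le)
    define s where "s = min (r - d x y) (r - d x z)"
    have "s > 0" using yz by (auto simp: s_def)
    moreover have "c < Lip_const f (mball w r)" if w: "w \<in> mball x s" for w
    proof -
      have "y \<in> mball w r" "z \<in> mball w r"
        using w yz triangle[of w x y] triangle[of w x z] by (auto simp: s_def commute)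
      then have "\<bar>f y - f z\<bar> \<le> Lip_const f (mball w r) * d y z"
        using Lip_const_bound[OF assms mball_subset_mspace] by blast
      then have "c * d y z < Lip_const f (mball w r) * d y z" using yz by simp
      then show ?thesis by (rule mult_right_less_imp_less) simp
    qed
    ultimately show ?thesis by (intro exI[of _ s]) auto
  qed
qed auto

lemma LIP_openin:
  assumes "f \<in> LIP"
  shows "openin mtopology {x \<in> M. c < f x}"
  unfolding openin_mtopology
proof (intro conjI allI impI)
  obtain L where L: "L > 0" "\<And>x y. x \<in> M \<Longrightarrow> y \<in> M \<Longrightarrow> \<bar>f x - f y\<bar> \<le> L * d x y"
    using assms unfolding LIP_iff by blast
  fix x assume "x \<in> {x \<in> M. c < f x}"
  then have x: "x \<in> M" "c < f x" by auto
  have "c < f y" if "y \<in> mball x ((f x - c) / L)" for y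
  proof -
    have "L * d x y < f x - c" using that L(1) by (simp add: field_simps)
    then show ?thesis using L(2)[OF x(1), of y] that by fastforce
  qed
  then show "\<exists>r>0. mball x r \<subseteq> {x \<in> M. c < f x}"
    using x L(1) by (intro exI[of _ "(f x - c) / L"]) auto
qed auto

end

context metric_measure_space
begin

lemma space_m: "space m = X"
proof -
  have "{U. openin mtopology U} \<subseteq> Pow X" by (auto simp: openin_mtopology)
  then show ?thesis using sets_eq_imp_space_eq[OF borel] by (simp add: space_measure_of_conv)
qed

lemma openin_sets: "openin mtopology U \<Longrightarrow> U \<in> sets m"
proof -
  have "{U. openin mtopology U} \<subseteq> Pow X" by (auto simp: openin_mtopology)
  then show "openin mtopology U \<Longrightarrow> U \<in> sets m" unfolding borel by (auto simp: sets_measure_of)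
qed

lemma closedin_sets: "closedin mtopology C \<Longrightarrow> C \<in> sets m"
  using openin_sets[of "X - C"] sets.compl_sets[of "X - C" m] unfolding closedin_def space_m
  by (simp add: double_diff)

lemma LIP_borel_measurable: "f \<in> LIP \<Longrightarrow> f \<in> borel_measurable m"
  unfolding borel_measurable_iff_greater space_m using LIP_openin openin_sets by blast

lemma asymptotic_slope_borel_measurable: "f \<in> LIP \<Longrightarrow> asymptotic_slope f \<in> borel_measurable m"
  unfolding borel_measurable_iff_less space_m using openin_asymptotic_slope_less openin_sets by blast

lemma Lip_const_ball_borel_measurable:
  "f \<in> LIP \<Longrightarrow> (\<lambda>x. Lip_const f (mball x r)) \<in> borel_measurable m"
  unfolding borel_measurable_iff_greater space_m using openin_Lip_const_ball_greater openin_sets by blast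

end

context metric_measure_space
begin

lemma emeasure_closure_of_mbounded:
  assumes "mbounded S" 
  shows "mtopology closure_of S \<in> sets m" "emeasure m (mtopology closure_of S) < \<infinity>"
proof -
  show S: "mtopology closure_of S \<in> sets m" by (intro closedin_sets) auto
  then show "emeasure m (mtopology closure_of S) < \<infinity>"
    using boundedly_finite mbounded_closure_of[OF assms] unfolding boundedly_finite_def by blast
qed

lemma LIP_boundedly_supported_bounded:
  assumes "u \<in> LIP" "boundedly_supported u"
  obtains A where "0 \<le> A" "\<And>x. x \<in> X \<Longrightarrow> \<bar>u x\<bar> \<le> A"
proof (cases "X = {}")
  case True
  then show ?thesis using that[of 0] by blast
next
  case False
  then obtain a where a: "a \<in> X" by blast
  obtain L where L: "0 < L" "\<And>x y. x \<in> X \<Longrightarrow> y \<in> X \<Longrightarrow> \<bar>u x - u y\<bar> \<le> L * d x y"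
    using assms(1) unfolding LIP_iff by blast
  obtain R where R: "R > 0" "\<And>y. y \<in> X \<Longrightarrow> u y \<noteq> 0 \<Longrightarrow> d a y < R"
    using assms(2) unfolding boundedly_supported_iff_ball[OF a] by blast
  have "\<bar>u x\<bar> \<le> \<bar>u a\<bar> + L * R" if x: "x \<in> X" for x
  proof (cases "u x = 0")
    case False
    have "L * d a x \<le> L * R" using R(2)[OF x False] L(1) by simp
    then show ?thesis using L(2)[OF a x] by linarith
  qed (use L(1) R(1) in simp)
  then show ?thesis using that[of "\<bar>u a\<bar> + L * R"] L(1) R(1) by simp
qed

lemma asymptotic_slope_off_support:
  assumes u: "u \<in> LIP" and x: "x \<in> X" "x \<notin> mtopology closure_of {x \<in> X. u x \<noteq> 0}"
  obtains r where "0 < r" "\<And>y. y \<in> mball x r \<Longrightarrow> u y = 0"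
proof -
  have "openin mtopology (X - mtopology closure_of {x \<in> X. u x \<noteq> 0})"
    using openin_diff[OF openin_topspace closedin_closure_of, of mtopology "{x \<in> X. u x \<noteq> 0}"] by simp
  then obtain r where "r > 0" "mball x r \<subseteq> X - mtopology closure_of {x \<in> X. u x \<noteq> 0}"
    using x unfolding openin_mtopology by blast
  moreover have "{x \<in> X. u x \<noteq> 0} \<subseteq> mtopology closure_of {x \<in> X. u x \<noteq> 0}"
    by (rule closure_of_subset) auto
  ultimately show thesis using that by fastforce
qed

end

section \<open>Cheeger energies\<close>

context metric_measure_space
begin

lemma Cheeger_energy_le_asymptotic_energy:
  assumes "u \<in> Lp m p"
  shows "Cheeger_energy m p u \<le> asymptotic_energy m p u"
  unfolding Cheeger_energy_def
proof (rule INF_lower2)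
  show "(\<lambda>_. u) \<in> {fs. Lp_converges m p fs u}"
    using assms by (simp add: Lp_converges_def Lp_norm_def)
  show "liminf (\<lambda>n. asymptotic_energy m p u) \<le> asymptotic_energy m p u"
    by (simp add: Liminf_const)
qed

lemma asymptotic_energy_lessD:
  assumes "asymptotic_energy m p u < c"
  shows "u \<in> LIP" "boundedly_supported u"
  using assms by (auto simp: asymptotic_energy_def split: if_splits)

text \<open>
  This lemma and the next one replace sequences by \<open>\<epsilon>\<close>-approximation: the Cheeger energy
  is at most \<open>c\<close> as soon as functions of asymptotic energy at most \<open>c\<close> approximate arbitrarily well.
\<close>

lemma Cheeger_energy_less_approx:
  assumes "Cheeger_energy m p f < c" "0 < e"
  obtains u where "u \<in> Lp m p" "Lp_norm m p (\<lambda>x. u x - f x) < e" "asymptotic_energy m p u < c"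
proof -
  obtain fs where fs: "Lp_converges m p fs f" "liminf (\<lambda>n. asymptotic_energy m p (fs n)) < c"
    using assms(1) unfolding Cheeger_energy_def INF_less_iff by blast
  have "\<forall>\<^sub>F n in sequentially. Lp_norm m p (\<lambda>x. fs n x - f x) < e"
    using fs(1) assms(2) unfolding Lp_converges_def by (auto intro: order_tendstoD)
  moreover have "\<exists>\<^sub>F n in sequentially. asymptotic_energy m p (fs n) < c"
  proof (rule ccontr)
    assume "\<not> ?thesis"
    then have "c \<le> liminf (\<lambda>n. asymptotic_energy m p (fs n))"
      by (intro Liminf_bounded) (simp add: not_frequently not_less)
    then show False using fs(2) by simp
  qed
  ultimately have "\<exists>\<^sub>F n in sequentially.
      asymptotic_energy m p (fs n) < c \<and> Lp_norm m p (\<lambda>x. fs n x - f x) < e"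
    by (intro frequently_eventually_frequently)
  then obtain n where "asymptotic_energy m p (fs n) < c" "Lp_norm m p (\<lambda>x. fs n x - f x) < e"
    by (auto dest: frequently_ex)
  then show thesis using that fs(1) unfolding Lp_converges_def by blast
qed

lemma Cheeger_energy_leI:
  assumes "f \<in> Lp m p"
    and "\<And>e. 0 < e \<Longrightarrow>
      \<exists>u\<in>Lp m p. Lp_norm m p (\<lambda>x. u x - f x) < e \<and> asymptotic_energy m p u \<le> c"
  shows "Cheeger_energy m p f \<le> c"
proof -
  have "\<exists>u\<in>Lp m p. Lp_norm m p (\<lambda>x. u x - f x) < inverse (real (Suc n)) \<and> asymptotic_energy m p u \<le> c"
    for n by (rule assms(2)) simp
  then obtain u where u: "\<And>n. u n \<in> Lp m p"
    "\<And>n. Lp_norm m p (\<lambda>x. u n x - f x) < inverse (real (Suc n))"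
    "\<And>n. asymptotic_energy m p (u n) \<le> c"
    by metis
  have "(\<lambda>n. Lp_norm m p (\<lambda>x. u n x - f x)) \<longlonglongrightarrow> 0"
    by (rule tendsto_sandwich[OF _ _ tendsto_const LIMSEQ_inverse_real_of_nat])
      (use less_imp_le[OF u(2)] in \<open>simp_all add: Lp_norm_nonneg\<close>)
  then have "Lp_converges m p u f" using u assms(1) by (simp add: Lp_converges_def)
  then have "Cheeger_energy m p f \<le> liminf (\<lambda>n. asymptotic_energy m p (u n))"
    unfolding Cheeger_energy_def by (intro INF_lower) simp
  also have "\<dots> \<le> c" using u(3) by (intro Liminf_le) auto
  finally show ?thesis .
qed

text \<open>
  Convexity of the slope in the function, which together with convexity of \<open>t powr p\<close> makes the sublevel sets
  of the asymptotic energy convex.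
\<close>

lemma asymptotic_slope_convex:
  assumes u: "u \<in> LIP" and v: "v \<in> LIP" and t: "0 \<le> t" "t \<le> 1"
  shows "(\<lambda>x. t * u x + (1 - t) * v x) \<in> LIP"
    and "asymptotic_slope (\<lambda>x. t * u x + (1 - t) * v x) x
      \<le> t * asymptotic_slope u x + (1 - t) * asymptotic_slope v x"
proof -
  have comb: "\<bar>(t * u y + (1 - t) * v y) - (t * u z + (1 - t) * v z)\<bar> \<le> (t * a + (1 - t) * b) * d y z"
    if "\<bar>u y - u z\<bar> \<le> a * d y z" "\<bar>v y - v z\<bar> \<le> b * d y z" for a b y z
  proof -
    have "\<bar>(t * u y + (1 - t) * v y) - (t * u z + (1 - t) * v z)\<bar>
        = \<bar>t * (u y - u z) + (1 - t) * (v y - v z)\<bar>"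
      by (simp add: algebra_simps)
    also have "\<dots> \<le> t * \<bar>u y - u z\<bar> + (1 - t) * \<bar>v y - v z\<bar>"
      using abs_triangle_ineq[of "t * (u y - u z)" "(1 - t) * (v y - v z)"] t by (simp add: abs_mult)
    also have "\<dots> \<le> t * (a * d y z) + (1 - t) * (b * d y z)"
      using that t by (intro add_mono mult_left_mono) auto
    finally show ?thesis by (simp add: algebra_simps)
  qed
  obtain L where L: "\<And>x y. x \<in> X \<Longrightarrow> y \<in> X \<Longrightarrow> \<bar>u x - u y\<bar> \<le> L * d x y"
    using u unfolding LIP_iff by blast
  obtain L' where L': "\<And>x y. x \<in> X \<Longrightarrow> y \<in> X \<Longrightarrow> \<bar>v x - v y\<bar> \<le> L' * d x y"
    using v unfolding LIP_iff by blast
  show w: "(\<lambda>x. t * u x + (1 - t) * v x) \<in> LIP"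
    by (rule LIPI) (rule comb[OF L L'])
  show "asymptotic_slope (\<lambda>x. t * u x + (1 - t) * v x) x
      \<le> t * asymptotic_slope u x + (1 - t) * asymptotic_slope v x"
  proof (rule asymptotic_slope_leI[OF w])
    show "0 \<le> t * asymptotic_slope u x + (1 - t) * asymptotic_slope v x"
      using t asymptotic_slope_nonneg[OF u, of x] asymptotic_slope_nonneg[OF v, of x] by simp
  next
    fix c assume c: "t * asymptotic_slope u x + (1 - t) * asymptotic_slope v x < c"
    define e where "e = c - (t * asymptotic_slope u x + (1 - t) * asymptotic_slope v x)"
    have e: "0 < e" using c by (simp add: e_def)
    obtain r where r: "0 < r" "\<And>y z. y \<in> mball x r \<Longrightarrow> z \<in> mball x r
        \<Longrightarrow> \<bar>u y - u z\<bar> \<le> (asymptotic_slope u x + e) * d y z"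
      using asymptotic_slope_local[OF u, of x "asymptotic_slope u x + e"] e by auto
    obtain s where s: "0 < s" "\<And>y z. y \<in> mball x s \<Longrightarrow> z \<in> mball x s
        \<Longrightarrow> \<bar>v y - v z\<bar> \<le> (asymptotic_slope v x + e) * d y z"
      using asymptotic_slope_local[OF v, of x "asymptotic_slope v x + e"] e by auto
    have "t * (asymptotic_slope u x + e) + (1 - t) * (asymptotic_slope v x + e) = c"
      by (simp add: e_def algebra_simps)
    then have "\<bar>(t * u y + (1 - t) * v y) - (t * u z + (1 - t) * v z)\<bar> \<le> c * d y z"
      if "y \<in> mball x (min r s)" "z \<in> mball x (min r s)" for y z
      using comb[OF r(2)[of y z] s(2)[of y z]] that by auto
    then show "\<exists>r>0. \<forall>y\<in>mball x r. \<forall>z\<in>mball x r.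
        \<bar>(t * u y + (1 - t) * v y) - (t * u z + (1 - t) * v z)\<bar> \<le> c * d y z"
      using r(1) s(1) by (intro exI[of _ "min r s"]) auto
  qed
qed

lemma convex_functions_energy_sublevel:
  assumes p: "1 \<le> p" and c: "c < \<infinity>"
  shows "convex_functions {u \<in> Lp m p. asymptotic_energy m p u \<le> c}"
  unfolding convex_functions_def
proof (intro ballI)
  fix u v and t :: real
  assume "u \<in> {u \<in> Lp m p. asymptotic_energy m p u \<le> c}"
    "v \<in> {u \<in> Lp m p. asymptotic_energy m p u \<le> c}" and "t \<in> {0..1}"
  then have u: "u \<in> Lp m p" "asymptotic_energy m p u \<le> c"
    and v: "v \<in> Lp m p" "asymptotic_energy m p v \<le> c" and t: "0 \<le> t" "t \<le> 1" by auto
  define w where "w = (\<lambda>x. t * u x + (1 - t) * v x)"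
  have fin: "asymptotic_energy m p u < \<infinity>" "asymptotic_energy m p v < \<infinity>"
    using u v c by auto
  note uL = asymptotic_energy_lessD[OF fin(1)] and vL = asymptotic_energy_lessD[OF fin(2)]
  have wL: "w \<in> LIP" unfolding w_def by (rule asymptotic_slope_convex(1)[OF uL(1) vL(1) t])
  have wB: "boundedly_supported w"
    unfolding boundedly_supported_iff
    by (rule mbounded_subset[of "{x \<in> X. u x \<noteq> 0} \<union> {x \<in> X. v x \<noteq> 0}"])
      (use uL(2) vL(2) in \<open>auto simp: mbounded_Un boundedly_supported_iff w_def\<close>)
  have wLp: "w \<in> Lp m p"
    unfolding w_def by (intro function_space_add function_space_scale Lp_function_space p u v)
  note [measurable] = asymptotic_slope_borel_measurable[OF uL(1)]
    asymptotic_slope_borel_measurable[OF vL(1)]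
  define I where "I = (\<lambda>f. \<integral>\<^sup>+ x. ennreal (asymptotic_slope f x powr p) \<partial>m)"
  have "I w \<le> (\<integral>\<^sup>+ x. (ennreal t * ennreal (asymptotic_slope u x powr p)
      + ennreal (1 - t) * ennreal (asymptotic_slope v x powr p)) \<partial>m)"
    unfolding I_def
  proof (rule nn_integral_mono)
    fix x
    have "asymptotic_slope w x powr p
        \<le> (t * asymptotic_slope u x + (1 - t) * asymptotic_slope v x) powr p"
      unfolding w_def using p asymptotic_slope_nonneg[OF wL, of x]
      by (intro powr_mono2 asymptotic_slope_convex[OF uL(1) vL(1) t]) (auto simp: w_def)
    also have "\<dots> \<le> t * asymptotic_slope u x powr p + (1 - t) * asymptotic_slope v x powr p"
      by (intro powr_convex_nonneg p t asymptotic_slope_nonneg uL vL)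
    finally show "ennreal (asymptotic_slope w x powr p) \<le> ennreal t * ennreal (asymptotic_slope u x powr p)
      + ennreal (1 - t) * ennreal (asymptotic_slope v x powr p)"
      using t by (simp add: ennreal_mult[symmetric] ennreal_plus[symmetric] ennreal_leI del: ennreal_plus)
  qed
  also have "\<dots> = ennreal t * I u + ennreal (1 - t) * I v"
    unfolding I_def by (simp add: nn_integral_add nn_integral_cmult)
  finally have "ennreal (1 / p) * I w \<le> ennreal (1 / p) * (ennreal t * I u + ennreal (1 - t) * I v)"
    by (intro mult_left_mono) auto
  also have "\<dots> = ennreal t * (ennreal (1 / p) * I u) + ennreal (1 - t) * (ennreal (1 / p) * I v)"
    by (simp add: distrib_left mult_ac)
  also have "\<dots> \<le> ennreal t * c + ennreal (1 - t) * c"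
    using u(2) v(2) uL vL by (intro add_mono mult_left_mono) (auto simp: asymptotic_energy_def I_def)
  also have "\<dots> = c"
    using t by (simp add: distrib_right[symmetric] ennreal_plus[symmetric] del: ennreal_plus)
  finally have "asymptotic_energy m p w \<le> c"
    using wL wB by (simp add: asymptotic_energy_def I_def)
  then show "(\<lambda>x. t * u x + (1 - t) * v x) \<in> {u \<in> Lp m p. asymptotic_energy m p u \<le> c}"
    using wLp by (simp add: w_def)
qed

lemma asymptotic_energy_empty:
  assumes "X = {}"
  shows "asymptotic_energy m p u = 0"
proof -
  have "u \<in> LIP"
    by (rule LIPI[of _ 0]) (use assms in blast)
  moreover have "{x \<in> X. u x \<noteq> 0} = {}"
    using assms by blast
  then have "boundedly_supported u"
    unfolding boundedly_supported_iff by (metis mbounded_empty)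
  moreover have "(\<integral>\<^sup>+ x. ennreal (asymptotic_slope u x powr p) \<partial>m) = 0"
    using assms space_m nn_integral_empty by blast
  ultimately show ?thesis by (simp add: asymptotic_energy_def)
qed

end

section \<open>Increasing distances and the lower bound\<close>

text \<open>
  A function of small \<open>e\<close>-energy is multiplied with cutoffs \<open>\<eta> n\<close> that are \<open>1 / Suc n\<close>-Lipschitz with respect to
  the larger distance \<open>d\<close> and tend to one. This raises the slope by at most \<open>A / Suc n\<close>, where \<open>A\<close>
  bounds the function, and only on its \<open>e\<close>-bounded support, which has finite measure.
\<close>

lemma boundedly_supported_approximation:
  fixes X :: "'a set"
  assumes "metric_measure_space X e m" "metric_measure_space X d m"
    and ed: "\<And>x y. x \<in> X \<Longrightarrow> y \<in> X \<Longrightarrow> e x y \<le> d x y"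
    and p: "1 < p" and u: "u \<in> Lp m p"
    and E: "Metric_space.asymptotic_energy X e m p u < c" and \<epsilon>: "0 < \<epsilon>" and X: "X \<noteq> {}"
  obtains v where "v \<in> Lp m p" "Lp_norm m p (\<lambda>x. v x - u x) < \<epsilon>"
    "Metric_space.asymptotic_energy X d m p v < c"
proof -
  interpret E: metric_measure_space X e m by fact
  interpret D: metric_measure_space X d m by fact
  have uL: "u \<in> E.LIP" and uB: "E.boundedly_supported u"
    using E.asymptotic_energy_lessD[OF E] by auto
  obtain a where a: "a \<in> X" using X by blast
  obtain L where L: "0 < L" "\<And>x y. x \<in> X \<Longrightarrow> y \<in> X \<Longrightarrow> \<bar>u x - u y\<bar> \<le> L * e x y"
    using uL unfolding E.LIP_iff by blast
  obtain A where A: "0 \<le> A" "\<And>x. x \<in> X \<Longrightarrow> \<bar>u x\<bar> \<le> A"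
    using E.LIP_boundedly_supported_bounded[OF uL uB] by blast
  define S where "S = E.mtopology closure_of {x \<in> X. u x \<noteq> 0}"
  have S: "S \<in> sets m" "emeasure m S < \<infinity>"
    unfolding S_def using E.emeasure_closure_of_mbounded uB unfolding E.boundedly_supported_iff by auto
  define r where "r = (\<lambda>n. inverse (real (Suc n)))"
  have r: "0 < r n" for n by (simp add: r_def)
  have rlim: "r \<longlonglongrightarrow> 0" unfolding r_def by (rule LIMSEQ_inverse_real_of_nat)
  define \<eta> where "\<eta> = (\<lambda>n x. min 1 (max 0 (2 - r n * d x a)))"
  define v where "v = (\<lambda>n x. \<eta> n x * u x)"
  have \<eta>01: "0 \<le> \<eta> n x" "\<eta> n x \<le> 1" for n x by (auto simp: \<eta>_def)
  have \<eta>_Lip: "\<bar>\<eta> n x - \<eta> n y\<bar> \<le> r n * d x y" if "x \<in> X" "y \<in> X" for n x y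
  proof -
    have "\<bar>r n * d x a - r n * d y a\<bar> \<le> r n * d x y"
      using D.mdist_reverse_triangle[of x a y] a that r[of n]
      by (simp add: D.commute[of a] right_diff_distrib[symmetric] abs_mult)
    then show ?thesis unfolding \<eta>_def by linarith
  qed
  have v_le: "\<bar>v n x\<bar> \<le> \<bar>u x\<bar>" for n x
    using \<eta>01[of n x] by (simp add: v_def abs_mult mult_left_le_one_le)
  have prod: "\<bar>v n y - v n z\<bar> \<le> (c' + r n * A) * d y z"
    if "\<bar>u y - u z\<bar> \<le> c' * e y z" "y \<in> X" "z \<in> X" "0 \<le> c'" for n y z c'
  proof -
    have "\<bar>v n y - v n z\<bar> = \<bar>\<eta> n y * (u y - u z) + (\<eta> n y - \<eta> n z) * u z\<bar>"
      by (simp add: v_def algebra_simps)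
    also have "\<dots> \<le> \<bar>\<eta> n y\<bar> * \<bar>u y - u z\<bar> + \<bar>\<eta> n y - \<eta> n z\<bar> * \<bar>u z\<bar>"
      using abs_triangle_ineq[of "\<eta> n y * (u y - u z)" "(\<eta> n y - \<eta> n z) * u z"] by (simp add: abs_mult)
    also have "\<dots> \<le> 1 * (c' * d y z) + r n * d y z * A"
    proof (intro add_mono mult_mono)
      show "\<bar>u y - u z\<bar> \<le> c' * d y z"
        using that ed[of y z] by (meson mult_left_mono order_trans)
    qed (use \<eta>01[of n y] \<eta>_Lip A that r[of n] in auto)
    finally show ?thesis by (simp add: algebra_simps)
  qed
  have vL: "v n \<in> D.LIP" for n
    by (rule D.LIPI[of _ "L + r n * A"]) (use prod[OF L(2)] L(1) in auto)
  have vB: "D.boundedly_supported (v n)" for n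
    unfolding D.boundedly_supported_iff_ball[OF a]
  proof (intro exI[of _ "2 * real (Suc n)"] conjI ballI impI)
    fix y assume "y \<in> X" "v n y \<noteq> 0"
    then have "r n * d a y < 2" unfolding v_def \<eta>_def D.commute[of a] by (auto split: split_min split_max)
    then show "d a y < 2 * real (Suc n)" by (simp add: r_def field_simps)
  qed simp
  have vLp: "v n \<in> Lp m p" for n
  proof -
    have [measurable]: "v n \<in> borel_measurable m" by (rule D.LIP_borel_measurable[OF vL])
    have "integrable m (\<lambda>x. \<bar>v n x\<bar> powr p)"
      by (rule Bochner_Integration.integrable_bound[OF LpD(2)[OF u]])
        (use p v_le in \<open>auto intro!: always_eventually powr_mono2\<close>)
    then show ?thesis by (simp add: Lp_def)
  qed
  have v_lim: "(\<lambda>n. v n x) \<longlonglongrightarrow> u x" for x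
  proof -
    have "(\<lambda>n. min 1 (max 0 (2 - r n * d x a)) * u x) \<longlonglongrightarrow> min 1 (max 0 (2 - 0 * d x a)) * u x"
      by (intro tendsto_intros rlim)
    then show ?thesis by (simp add: v_def \<eta>_def)
  qed
  have norm_lim: "(\<lambda>n. Lp_norm m p (\<lambda>x. v n x - u x)) \<longlonglongrightarrow> 0"
  proof (rule Lp_norm_tendsto_zeroI)
    note [measurable] = LpD(1)[OF u] LpD(1)[OF vLp]
    have "(\<lambda>n. LINT x|m. \<bar>v n x - u x\<bar> powr p) \<longlonglongrightarrow> (LINT x|m. 0)"
    proof (rule integral_dominated_convergence[where w = "\<lambda>x. \<bar>u x\<bar> powr p"])
      show "integrable m (\<lambda>x. \<bar>u x\<bar> powr p)" by (rule LpD(2)[OF u])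
      have "(\<lambda>n. \<bar>v n x - u x\<bar> powr p) \<longlonglongrightarrow> 0" for x
        using p tendsto_rabs_zero[OF LIM_zero[OF v_lim[of x]]]
        by (intro tendsto_zero_powrI[OF _ tendsto_const]) auto
      then show "AE x in m. (\<lambda>n. \<bar>v n x - u x\<bar> powr p) \<longlonglongrightarrow> 0" by simp
      have "\<bar>v n x - u x\<bar> \<le> \<bar>u x\<bar>" for n x
      proof -
        have "v n x - u x = - ((1 - \<eta> n x) * u x)" by (simp add: v_def algebra_simps)
        then have "\<bar>v n x - u x\<bar> = (1 - \<eta> n x) * \<bar>u x\<bar>"
          using \<eta>01[of n x] by (simp add: abs_mult)
        then show ?thesis using \<eta>01[of n x] by (simp add: mult_left_le_one_le)
      qed
      then show "AE x in m. norm (\<bar>v n x - u x\<bar> powr p) \<le> \<bar>u x\<bar> powr p" for n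
        using p by (intro always_eventually allI) (simp add: powr_mono2)
    qed simp_all
    then show "(\<lambda>n. LINT x|m. \<bar>v n x - u x\<bar> powr p) \<longlonglongrightarrow> 0" by simp
  qed (use p in simp)
  have slope: "D.asymptotic_slope (v n) x \<le> (E.asymptotic_slope u x + r n * A) * indicator S x"
    if x: "x \<in> X" for n x
  proof (cases "x \<in> S")
    case True
    have "D.asymptotic_slope (v n) x \<le> E.asymptotic_slope u x + r n * A"
    proof (rule D.asymptotic_slope_leI[OF vL])
      fix c' assume c': "E.asymptotic_slope u x + r n * A < c'"
      then obtain s where s: "0 < s" "\<And>y z. y \<in> E.mball x s \<Longrightarrow> z \<in> E.mball x s
          \<Longrightarrow> \<bar>u y - u z\<bar> \<le> (c' - r n * A) * e y z"
        using E.asymptotic_slope_local[OF uL, of x "c' - r n * A"] by auto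
      have sub: "y \<in> E.mball x s" if "y \<in> D.mball x s" for y
        using that ed[of x y] by auto
      have "0 \<le> c' - r n * A" using c' E.asymptotic_slope_nonneg[OF uL, of x] by simp
      then have "\<bar>v n y - v n z\<bar> \<le> c' * d y z" if "y \<in> D.mball x s" "z \<in> D.mball x s" for y z
        using prod[OF s(2)[OF sub sub], of y z n] that by auto
      then show "\<exists>r>0. \<forall>y\<in>D.mball x r. \<forall>z\<in>D.mball x r. \<bar>v n y - v n z\<bar> \<le> c' * d y z"
        using s(1) by blast
    next
      show "0 \<le> E.asymptotic_slope u x + r n * A"
        using E.asymptotic_slope_nonneg[OF uL, of x] A(1) r[of n] by simp
    qed
    then show ?thesis using True by simp
  next
    case False
    obtain s where s: "0 < s" "\<And>y. y \<in> E.mball x s \<Longrightarrow> u y = 0"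
      using E.asymptotic_slope_off_support[OF uL x] False unfolding S_def by blast
    have "v n y = 0" if "y \<in> D.mball x s" for y
      using that ed[of x y] s(2)[of y] by (auto simp: v_def)
    then have "D.asymptotic_slope (v n) x \<le> 0"
      by (intro D.asymptotic_slope_le[OF vL s(1)]) auto
    then show ?thesis using False by simp
  qed
  note [measurable] = E.asymptotic_slope_borel_measurable[OF uL]
  define I where "I = (\<lambda>n. \<integral>\<^sup>+x. ennreal ((E.asymptotic_slope u x + r n * A) powr p) * indicator S x \<partial>m)"
  have "I \<longlonglongrightarrow> (\<integral>\<^sup>+x. ennreal (E.asymptotic_slope u x powr p) * indicator S x \<partial>m)"
    unfolding I_def
  proof (rule nn_integral_powr_on_finite_tendsto[where C = "L + A"])
    fix x n
    show "0 \<le> E.asymptotic_slope u x + r n * A"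
      using E.asymptotic_slope_nonneg[OF uL, of x] A(1) r[of n] by simp
    have "E.asymptotic_slope u x \<le> L"
      using L by (intro E.asymptotic_slope_le[OF uL, of 1]) auto
    moreover have "r n * A \<le> 1 * A" using A(1) by (intro mult_right_mono) (auto simp: r_def field_simps)
    ultimately show "E.asymptotic_slope u x + r n * A \<le> L + A" by simp
    have "(\<lambda>n. E.asymptotic_slope u x + r n * A) \<longlonglongrightarrow> E.asymptotic_slope u x + 0 * A"
      by (intro tendsto_intros rlim)
    then show "(\<lambda>n. E.asymptotic_slope u x + r n * A) \<longlonglongrightarrow> E.asymptotic_slope u x" by simp
  qed (use p S in auto)
  then have "(\<lambda>n. ennreal (1 / p) * I n) \<longlonglongrightarrow>
      ennreal (1 / p) * (\<integral>\<^sup>+x. ennreal (E.asymptotic_slope u x powr p) * indicator S x \<partial>m)"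
    by (intro ennreal_tendsto_cmult) auto
  moreover have "ennreal (1 / p) * (\<integral>\<^sup>+x. ennreal (E.asymptotic_slope u x powr p) * indicator S x \<partial>m) < c"
  proof -
    have "ennreal (1 / p) * (\<integral>\<^sup>+x. ennreal (E.asymptotic_slope u x powr p) * indicator S x \<partial>m)
        \<le> E.asymptotic_energy m p u"
      using uL uB unfolding E.asymptotic_energy_def
      by (auto intro!: mult_left_mono nn_integral_mono split: split_indicator)
    then show ?thesis using E by simp
  qed
  ultimately have ev: "\<forall>\<^sub>F n in sequentially. ennreal (1 / p) * I n < c"
    by (rule order_tendstoD)
  moreover have "\<forall>\<^sub>F n in sequentially. Lp_norm m p (\<lambda>x. v n x - u x) < \<epsilon>"
    using norm_lim \<epsilon> by (rule order_tendstoD)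
  ultimately have "\<forall>\<^sub>F n in sequentially. ennreal (1 / p) * I n < c \<and> Lp_norm m p (\<lambda>x. v n x - u x) < \<epsilon>"
    by (rule eventually_conj)
  then obtain n where n: "ennreal (1 / p) * I n < c" "Lp_norm m p (\<lambda>x. v n x - u x) < \<epsilon>"
    using eventually_happens'[OF sequentially_bot] by blast
  have "D.asymptotic_energy m p (v n) \<le> ennreal (1 / p) * I n"
    unfolding D.asymptotic_energy_def I_def
  proof (simp add: vL vB, intro mult_left_mono nn_integral_mono)
    fix x assume "x \<in> space m"
    then have "D.asymptotic_slope (v n) x powr p \<le> ((E.asymptotic_slope u x + r n * A) * indicator S x) powr p"
      using slope p D.asymptotic_slope_nonneg[OF vL] E.space_m by (intro powr_mono2) auto
    then show "ennreal (D.asymptotic_slope (v n) x powr p)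
        \<le> ennreal ((E.asymptotic_slope u x + r n * A) powr p) * indicator S x"
      using ennreal_leI by (auto split: split_indicator)
  qed auto
  then show thesis using that[OF vLp n(2)] n(1) by simp
qed

text \<open>
  Separability and the Borel sets depend only on the topology. So the first assumption, that all
  \<open>(X, di i, m)\<close> are metric measure spaces, covers complete distances that induce the topology of \<open>d\<close>
  and for which \<open>m\<close> is boundedly finite.
\<close>

locale metrics_increasing_to = D: metric_measure_space X d m
  for X :: "'a set" and d :: "'a \<Rightarrow> 'a \<Rightarrow> real" and m :: "'a measure" +
  fixes di :: "nat \<Rightarrow> 'a \<Rightarrow> 'a \<Rightarrow> real" and p :: real
  assumes mms: "\<And>i. metric_measure_space X (di i) m"
    and mono: "\<And>i x y. x \<in> X \<Longrightarrow> y \<in> X \<Longrightarrow> di i x y \<le> di (Suc i) x y"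
    and lim: "\<And>x y. x \<in> X \<Longrightarrow> y \<in> X \<Longrightarrow> (\<lambda>i. di i x y) \<longlonglongrightarrow> d x y"
    and p: "1 < p"
begin

lemma incseq_di: "x \<in> X \<Longrightarrow> y \<in> X \<Longrightarrow> incseq (\<lambda>i. di i x y)"
  by (intro incseq_SucI mono)

lemma di_le_d: "x \<in> X \<Longrightarrow> y \<in> X \<Longrightarrow> di i x y \<le> d x y"
  using incseq_le[OF incseq_di lim] by blast

lemma di_0_le_di: "x \<in> X \<Longrightarrow> y \<in> X \<Longrightarrow> di 0 x y \<le> di i x y"
  using incseqD[OF incseq_di] by blast

text \<open>
  If the inequality failed there would be a level \<open>c\<close> strictly between both sides. Infinitely many \<open>fs i\<close>
  then lie in the closure of the convex set \<open>K\<close> of level \<open>c\<close>, whereas \<open>f\<close> has positive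
  distance from \<open>K\<close>; a functional separating \<open>f\<close> from \<open>K\<close> contradicts weak convergence.
\<close>

lemma Cheeger_energy_liminf:
  assumes conv: "Lp_converges_weakly m p fs f"
  shows "D.Cheeger_energy m p f \<le> liminf (\<lambda>i. Metric_space.Cheeger_energy X (di i) m p (fs i))"
proof (cases "X = {}")
  case True
  have "D.Cheeger_energy m p f \<le> D.asymptotic_energy m p f"
    using conv by (intro D.Cheeger_energy_le_asymptotic_energy) (simp add: Lp_converges_weakly_def)
  then show ?thesis by (simp add: D.asymptotic_energy_empty[OF True])
next
  case False
  have p1: "1 \<le> p" using p by simp
  have fs: "\<And>i. fs i \<in> Lp m p" and f: "f \<in> Lp m p"
    using conv by (auto simp: Lp_converges_weakly_def)
  show ?thesis
  proof (rule ccontr)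
    assume "\<not> ?thesis"
    then obtain c where c: "liminf (\<lambda>i. Metric_space.Cheeger_energy X (di i) m p (fs i)) < c"
      "c < D.Cheeger_energy m p f"
      using dense[of "liminf (\<lambda>i. Metric_space.Cheeger_energy X (di i) m p (fs i))"] by (auto simp: not_le)
    have c_fin: "c < \<infinity>" by (rule less_le_trans[OF c(2)]) simp
    have freq: "\<exists>\<^sub>F i in sequentially. Metric_space.Cheeger_energy X (di i) m p (fs i) < c"
    proof (rule ccontr)
      assume "\<not> ?thesis"
      then have "c \<le> liminf (\<lambda>i. Metric_space.Cheeger_energy X (di i) m p (fs i))"
        by (intro Liminf_bounded) (simp add: not_frequently not_less)
      then show False using c(1) by simp
    qed
    define K where "K = {u \<in> Lp m p. D.asymptotic_energy m p u \<le> c}"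
    have near_K: "\<exists>k\<in>K. Lp_norm m p (\<lambda>x. k x - fs i x) < \<epsilon>"
      if low: "Metric_space.Cheeger_energy X (di i) m p (fs i) < c" and \<epsilon>: "0 < \<epsilon>" for i \<epsilon>
    proof -
      interpret E: metric_measure_space X "di i" m by (rule mms)
      obtain u where u: "u \<in> Lp m p" "Lp_norm m p (\<lambda>x. u x - fs i x) < \<epsilon> / 2"
        "E.asymptotic_energy m p u < c"
        using E.Cheeger_energy_less_approx[OF low, of "\<epsilon> / 2"] \<epsilon> by auto
      obtain v where v: "v \<in> Lp m p" "Lp_norm m p (\<lambda>x. v x - u x) < \<epsilon> / 2"
        "D.asymptotic_energy m p v < c"
        using boundedly_supported_approximation[OF mms D.metric_measure_space_axioms di_le_d p u(1,3) _ False, of "\<epsilon> / 2"]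
          \<epsilon> by auto
      have "Lp_norm m p (\<lambda>x. v x - fs i x) < \<epsilon>"
        using Lp_norm_diff_triangle[OF p1 v(1) u(1) fs[of i]] u(2) v(2) by linarith
      then show ?thesis using v by (auto simp: K_def intro!: bexI[of _ v])
    qed
    have "\<exists>\<delta>>0. \<forall>k\<in>K. \<delta> \<le> Lp_norm m p (\<lambda>x. k x - f x)"
    proof (rule ccontr)
      assume far: "\<not> ?thesis"
      have "D.Cheeger_energy m p f \<le> c"
      proof (rule D.Cheeger_energy_leI[OF f])
        fix e :: real assume "0 < e"
        then have "\<exists>k\<in>K. Lp_norm m p (\<lambda>x. k x - f x) < e"
          using far by (meson not_le)
        then show "\<exists>u\<in>Lp m p. Lp_norm m p (\<lambda>x. u x - f x) < e \<and> D.asymptotic_energy m p u \<le> c"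
          by (auto simp: K_def)
      qed
      then show False using c(2) by simp
    qed
    then obtain \<delta> where \<delta>: "0 < \<delta>" "\<And>k. k \<in> K \<Longrightarrow> \<delta> \<le> Lp_norm m p (\<lambda>x. k x - f x)"
      by blast
    have "K \<noteq> {}" using frequently_ex[OF freq] near_K[of _ 1] by auto
    moreover have "convex_functions K"
      unfolding K_def by (rule D.convex_functions_energy_sublevel[OF p1 c_fin])
    moreover have "K \<subseteq> Lp m p" by (auto simp: K_def)
    ultimately obtain \<phi> where \<phi>: "\<phi> \<in> Lp_dual m p" "\<And>h. h \<in> Lp m p \<Longrightarrow> \<phi> h \<le> Lp_norm m p h"
      "\<And>k. k \<in> K \<Longrightarrow> \<phi> f + \<delta> \<le> \<phi> k"
      using convex_at_distance_separated[OF p1 _ _ _ f \<delta>(2)] by blast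
    have \<phi>_add: "\<phi> (\<lambda>x. g x + h x) = \<phi> g + \<phi> h" if "g \<in> Lp m p" "h \<in> Lp m p" for g h
      using \<phi>(1) that by (simp add: Lp_dual_def)
    have "\<phi> f + \<delta> / 2 \<le> \<phi> (fs i)" if low: "Metric_space.Cheeger_energy X (di i) m p (fs i) < c" for i
    proof -
      obtain k where k: "k \<in> K" "Lp_norm m p (\<lambda>x. k x - fs i x) < \<delta> / 2"
        using near_K[OF low, of "\<delta> / 2"] \<delta>(1) by auto
      then have kL: "k \<in> Lp m p" by (simp add: K_def)
      have "\<phi> (\<lambda>x. fs i x + (k x - fs i x)) = \<phi> (fs i) + \<phi> (\<lambda>x. k x - fs i x)"
        by (rule \<phi>_add[OF fs Lp_diff[OF p1 kL fs]])
      then show ?thesis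
        using \<phi>(2)[OF Lp_diff[OF p1 kL fs[of i]]] \<phi>(3)[OF k(1)] k(2) by simp
    qed
    then have "\<exists>\<^sub>F i in sequentially. \<phi> f + \<delta> / 2 \<le> \<phi> (fs i)"
      using freq by (rule frequently_elim1[rotated])
    moreover have "(\<lambda>i. \<phi> (fs i)) \<longlonglongrightarrow> \<phi> f"
      using conv \<phi>(1) by (simp add: Lp_converges_weakly_def)
    then have "\<forall>\<^sub>F i in sequentially. \<phi> (fs i) < \<phi> f + \<delta> / 2"
      using \<delta>(1) by (intro order_tendstoD) auto
    ultimately show False
      by (auto simp: frequently_def not_le)
  qed
qed

end

section \<open>Localized McShane extension\<close>

text \<open>
  The heart of the recovery construction: \<open>F\<close> is the infimum of the functions
  \<open>V y x = g y + (\<rho> y + \<epsilon>) * e x y + 4 * L * max 0 (e x y - r / 2)\<close> over the centres \<open>y \<in> K\<close>, where \<open>\<rho> y\<close> is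
  the Lipschitz constant of \<open>g\<close> on the \<open>d\<close>-ball of radius \<open>r\<close> around \<open>y\<close>. Each \<open>V y\<close> is Lipschitz with
  constant \<open>L + \<epsilon> + 4 * L\<close>. The key estimate is \<open>V y x \<ge> g x - L * \<eta> + \<epsilon> * e x y\<close> on \<open>K\<close>: it bounds \<open>F\<close> from below,
  and it localizes, since the value at \<open>x\<close> can almost be attained only where \<open>\<epsilon> * e x y\<close> is of the order
  of the error \<open>L * \<eta>\<close>. The factor \<open>4\<close> and the radius \<open>r / 2\<close> are such that the steep term is at least
  \<open>L * e x y\<close> at all distances \<open>e x y \<ge> 2 * r / 3\<close> and is still zero close to the centre.
\<close>

lemma localized_mcshane_extension:
  fixes X :: "'a set"
  assumes "Metric_space X d" "Metric_space X e"
    and L: "0 < L" "\<And>x y. x \<in> X \<Longrightarrow> y \<in> X \<Longrightarrow> \<bar>g x - g y\<bar> \<le> L * d x y"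
    and K: "K \<subseteq> X" "K \<noteq> {}" and close: "\<And>x y. x \<in> K \<Longrightarrow> y \<in> K \<Longrightarrow> d x y \<le> e x y + \<eta>"
    and r: "0 < r" and \<epsilon>: "0 < \<epsilon>" and \<eta>: "\<eta> \<le> r / 4" "L * \<eta> \<le> \<epsilon> * r / 8"
  obtains F where
    "\<And>x y. x \<in> X \<Longrightarrow> y \<in> X \<Longrightarrow> \<bar>F x - F y\<bar> \<le> (5 * L + \<epsilon>) * e x y"
    "\<And>x. x \<in> K \<Longrightarrow> g x - L * \<eta> \<le> F x" "\<And>x. x \<in> K \<Longrightarrow> F x \<le> g x"
    "\<And>x. x \<in> K \<Longrightarrow> \<exists>\<delta>>0. \<forall>y\<in>Metric_space.mball X e x \<delta>. \<forall>z\<in>Metric_space.mball X e x \<delta>.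
      \<bar>F y - F z\<bar> \<le> (Metric_space.Lip_const d g (Metric_space.mball X d x (2 * r)) + \<epsilon>) * e y z"
proof -
  interpret D: Metric_space X d by fact
  interpret E: Metric_space X e by fact
  have gL: "g \<in> D.LIP" using L unfolding D.LIP_iff by blast
  define \<rho> where "\<rho> = (\<lambda>y. D.Lip_const g (D.mball y r))"
  define C where "C = 5 * L + \<epsilon>"
  have C: "0 < C" using L \<epsilon> by (simp add: C_def)
  have \<rho>0: "0 \<le> \<rho> y" for y unfolding \<rho>_def by (rule D.Lip_const_nonneg[OF gL]) auto
  have \<rho>L: "\<rho> y \<le> L" for y unfolding \<rho>_def using L by (intro D.Lip_const_le) auto
  define V where "V = (\<lambda>y x. g y + (\<rho> y + \<epsilon>) * e x y + 4 * L * max 0 (e x y - r / 2))"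
  define F where "F = (\<lambda>x. INF y\<in>K. V y x)"
  have V_Lip: "V y x \<le> V y x' + C * e x x'" if "x \<in> X" "x' \<in> X" "y \<in> X" for x x' y
  proof -
    have t: "e x y - e x' y \<le> e x x'" using E.triangle[of x x' y] that by simp
    have "(\<rho> y + \<epsilon>) * (e x y - e x' y) \<le> (\<rho> y + \<epsilon>) * e x x'"
      using t \<rho>0[of y] \<epsilon> by (intro mult_left_mono) auto
    also have "\<dots> \<le> (L + \<epsilon>) * e x x'" using \<rho>L by (intro mult_right_mono) auto
    finally have 1: "(\<rho> y + \<epsilon>) * (e x y - e x' y) \<le> (L + \<epsilon>) * e x x'" .
    have "max 0 (e x y - r / 2) - max 0 (e x' y - r / 2) \<le> e x x'"
      using t E.nonneg[of x x'] by linarith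
    then have "4 * L * (max 0 (e x y - r / 2) - max 0 (e x' y - r / 2)) \<le> 4 * L * e x x'"
      using L by (intro mult_left_mono) auto
    then show ?thesis using 1 by (simp add: V_def C_def algebra_simps)
  qed
  have V_ge: "g x - L * \<eta> + \<epsilon> * e x y \<le> V y x" if x: "x \<in> K" and y: "y \<in> K" for x y
  proof -
    have xy: "x \<in> X" "y \<in> X" using x y K by auto
    have dxy: "d x y \<le> e x y + \<eta>" by (rule close[OF x y])
    have \<eta>0: "0 \<le> \<eta>" using close[OF x x] xy by simp
    show ?thesis
    proof (cases "d x y < r")
      case True
      have "\<bar>g x - g y\<bar> \<le> \<rho> y * d x y"
        unfolding \<rho>_def using True xy r by (intro D.Lip_const_bound[OF gL]) (auto simp: D.commute)
      also have "\<dots> \<le> \<rho> y * (e x y + \<eta>)" using dxy \<rho>0 by (intro mult_left_mono) auto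
      also have "\<dots> \<le> \<rho> y * e x y + L * \<eta>"
        using mult_right_mono[OF \<rho>L[of y] \<eta>0] by (simp add: distrib_left)
      finally have "g x - L * \<eta> + \<epsilon> * e x y \<le> g y + (\<rho> y + \<epsilon>) * e x y"
        by (simp add: distrib_right)
      moreover have "0 \<le> 4 * L * max 0 (e x y - r / 2)" using L by simp
      ultimately show ?thesis unfolding V_def by linarith
    next
      case False
      \<comment> \<open>the steep part of the cost pays for a jump of length at least \<open>3 * r / 4\<close>\<close>
      have t: "3 * r / 4 \<le> e x y" using False dxy \<eta> by linarith
      have "g x - g y \<le> L * (e x y + \<eta>)"
        using L(2)[OF xy] mult_left_mono[OF dxy, of L] L(1) by linarith
      moreover have "L * e x y \<le> L * (4 * (e x y - r / 2))"
        using t r L(1) by (intro mult_left_mono) auto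
      moreover have "L * (4 * (e x y - r / 2)) \<le> L * (4 * max 0 (e x y - r / 2))"
        using L(1) by (intro mult_left_mono; linarith)
      moreover have "\<epsilon> * e x y \<le> (\<rho> y + \<epsilon>) * e x y" using \<rho>0 by (intro mult_right_mono) auto
      ultimately show ?thesis unfolding V_def by (simp add: distrib_left)
    qed
  qed
  have bdd: "bdd_below ((\<lambda>y. V y x) ` K)" if x: "x \<in> X" for x
  proof -
    obtain z where z: "z \<in> K" using K by blast
    have "g z - L * \<eta> - C * e z x \<le> V y x" if y: "y \<in> K" for y
    proof -
      have "V y z \<le> V y x + C * e z x" by (rule V_Lip) (use x y z K in auto)
      moreover have "0 \<le> \<epsilon> * e z y" using \<epsilon> by simp
      ultimately show ?thesis using V_ge[OF z y] by linarith
    qed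
    then show ?thesis by (intro bdd_belowI2[of _ "g z - L * \<eta> - C * e z x"])
  qed
  have F_le: "F x \<le> V y x" if "x \<in> X" "y \<in> K" for x y
    unfolding F_def by (rule cINF_lower[OF bdd[OF that(1)] that(2)])
  have F_ge: "b \<le> F x" if "\<And>y. y \<in> K \<Longrightarrow> b \<le> V y x" for b x
    unfolding F_def using K(2) that by (intro cINF_greatest) auto
  have F_near: "\<exists>y\<in>K. V y x < F x + \<theta>" if "0 < \<theta>" for x \<theta>
  proof -
    have "\<exists>v\<in>(\<lambda>y. V y x) ` K. v < F x + \<theta>"
      by (rule cInf_lessD) (use K(2) that in \<open>auto simp: F_def\<close>)
    then show ?thesis by auto
  qed
  have F_Lip1: "F x \<le> F y + C * e x y" if "x \<in> X" "y \<in> X" for x y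
  proof -
    have "F x - C * e x y \<le> F y"
    proof (rule F_ge)
      fix z assume z: "z \<in> K"
      show "F x - C * e x y \<le> V z y"
        using F_le[OF that(1) z] V_Lip[OF that, of z] z K by auto
    qed
    then show ?thesis by simp
  qed
  have F_Lip: "\<bar>F x - F y\<bar> \<le> C * e x y" if "x \<in> X" "y \<in> X" for x y
    using F_Lip1[OF that] F_Lip1[OF that(2,1)] by (simp add: E.commute[of y x])
  have F_upper: "F x \<le> g x" if "x \<in> K" for x
    using F_le[of x x] that K r by (auto simp: V_def)
  have F_lower: "g x - L * \<eta> \<le> F x" if x: "x \<in> K" for x
  proof (rule F_ge)
    fix y assume "y \<in> K"
    then show "g x - L * \<eta> \<le> V y x"
      using V_ge[OF x, of y] \<epsilon> E.nonneg[of x y] by (smt (verit) mult_nonneg_nonneg)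
  qed
  have F_local: "\<exists>\<delta>>0. \<forall>y\<in>E.mball x \<delta>. \<forall>z\<in>E.mball x \<delta>.
      \<bar>F y - F z\<bar> \<le> (D.Lip_const g (D.mball x (2 * r)) + \<epsilon>) * e y z" if x: "x \<in> K" for x
  proof -
    have xX: "x \<in> X" using x K by blast
    define \<Lambda> where "\<Lambda> = D.Lip_const g (D.mball x (2 * r)) + \<epsilon>"
    \<comment> \<open>moving by \<open>\<delta>\<close> changes both \<open>F\<close> and each \<open>V y\<close> by at most \<open>C * \<delta>\<close>\<close>
    define \<delta> where "\<delta> = min (r / 8) (\<epsilon> * r / (32 * C))"
    have \<delta>: "0 < \<delta>" "\<delta> \<le> r / 8" "2 * (C * \<delta>) \<le> \<epsilon> * r / 16"
    proof -
      show "0 < \<delta>" "\<delta> \<le> r / 8" using r \<epsilon> C by (auto simp: \<delta>_def)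
      have "C * \<delta> \<le> C * (\<epsilon> * r / (32 * C))" using C by (intro mult_left_mono) (auto simp: \<delta>_def)
      then show "2 * (C * \<delta>) \<le> \<epsilon> * r / 16" using C by simp
    qed
    have one_sided: "F u \<le> F v + \<Lambda> * e u v" if u: "u \<in> E.mball x \<delta>" and v: "v \<in> E.mball x \<delta>" for u v
    proof (rule field_le_epsilon)
      fix \<theta>' :: real assume \<theta>': "0 < \<theta>'"
      define \<theta> where "\<theta> = min \<theta>' (\<epsilon> * r / 16)"
      have \<theta>: "0 < \<theta>" "\<theta> \<le> \<theta>'" "\<theta> \<le> \<epsilon> * r / 16" using \<theta>' \<epsilon> r by (auto simp: \<theta>_def)
      obtain y where y: "y \<in> K" "V y v < F v + \<theta>" using F_near[OF \<theta>(1)] by blast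
      have mem: "u \<in> X" "v \<in> X" "y \<in> X" and dist: "e x u < \<delta>" "e x v < \<delta>" using u v y K by auto
      have "V y x \<le> V y v + C * e x v" by (rule V_Lip) (use xX mem in auto)
      moreover have "F v \<le> F x + C * e v x" by (rule F_Lip1) (use xX mem in auto)
      moreover have "C * e x v \<le> C * \<delta>" "C * e v x \<le> C * \<delta>"
        using dist C by (auto simp: E.commute[of v x])
      ultimately have "\<epsilon> * e x y \<le> L * \<eta> + 2 * (C * \<delta>) + \<theta>"
        using V_ge[OF x y(1)] F_upper[OF x] y(2) by linarith
      then have "\<epsilon> * e x y \<le> \<epsilon> * (r / 4)" using \<eta>(2) \<delta>(3) \<theta>(3) by (simp add: field_simps)
      \<comment> \<open>almost minimal centres are close to \<open>x\<close>, where the steep part of the cost vanishes\<close>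
      then have s: "e x y \<le> r / 4" using \<epsilon> by simp
      have "e u y \<le> r / 2" "e v y \<le> r / 2"
        using E.triangle[of u x y] E.triangle[of v x y] mem xX dist s \<delta>(2) r
        by (auto simp: E.commute[of u x] E.commute[of v x])
      then have "V y u = g y + (\<rho> y + \<epsilon>) * e u y" "V y v = g y + (\<rho> y + \<epsilon>) * e v y"
        by (auto simp: V_def)
      then have "V y u - V y v = (\<rho> y + \<epsilon>) * (e u y - e v y)" by (simp add: algebra_simps)
      also have "\<dots> \<le> (\<rho> y + \<epsilon>) * e u v"
        using E.triangle[of u v y] mem \<rho>0[of y] \<epsilon> by (intro mult_left_mono) auto
      also have "\<dots> \<le> \<Lambda> * e u v"
      proof (intro mult_right_mono)
        have "d x y < r" using close[OF x y(1)] s \<eta>(1) r by linarith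
        then have "D.mball y r \<subseteq> D.mball x (2 * r)"
          using D.triangle[of x y] xX mem by fastforce
        then have "\<rho> y \<le> D.Lip_const g (D.mball x (2 * r))"
          unfolding \<rho>_def by (intro D.Lip_const_mono[OF gL]) auto
        then show "\<rho> y + \<epsilon> \<le> \<Lambda>" by (simp add: \<Lambda>_def)
      qed simp
      finally show "F u \<le> F v + \<Lambda> * e u v + \<theta>'"
        using F_le[OF mem(1) y(1)] y(2) \<theta>(2) by linarith
    qed
    have "\<bar>F u - F v\<bar> \<le> \<Lambda> * e u v" if "u \<in> E.mball x \<delta>" "v \<in> E.mball x \<delta>" for u v
      using one_sided[OF that] one_sided[OF that(2,1)] by (simp add: E.commute[of v u])
    then show ?thesis using \<delta>(1) unfolding \<Lambda>_def by blast
  qed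
  show thesis
    by (rule that[OF F_Lip[unfolded C_def] F_lower F_upper F_local])
qed

text \<open>
  The extension \<open>F\<close> is subjected to a soft threshold \<open>T\<close> at height \<open>\<tau>\<close> and then cut off by \<open>w\<close>, which decreases with
  slope one and vanishes from distance \<open>A + 1 + R\<close> on. The threshold exceeds the error \<open>L * \<eta>\<close>, so the result is
  locally zero at the points of \<open>K\<close> where \<open>g\<close> vanishes; this avoids an energy of order
  \<open>\<epsilon>\<close> on a region that has nothing to do with the support of \<open>g\<close>. Where \<open>g\<close> does not vanish, \<open>w\<close> is
  larger than \<open>\<bar>F\<bar>\<close> and the cutoff is inactive. The Lipschitz constant of
  the result is at most the larger one of \<open>1\<close> and that of \<open>F\<close>.
\<close>

lemma truncated_mcshane_extension:
  fixes X :: "'a set"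
  assumes "Metric_space X d" "Metric_space X e"
    and L: "0 < L" "\<And>x y. x \<in> X \<Longrightarrow> y \<in> X \<Longrightarrow> \<bar>g x - g y\<bar> \<le> L * d x y"
    and K: "K \<subseteq> X" and a: "a \<in> K" and close: "\<And>x y. x \<in> K \<Longrightarrow> y \<in> K \<Longrightarrow> d x y \<le> e x y + \<eta>"
    and r: "0 < r" and \<epsilon>: "0 < \<epsilon>" and \<eta>: "\<eta> \<le> r / 4" "L * \<eta> \<le> \<epsilon> * r / 8"
    and \<tau>: "L * \<eta> < \<tau>" "L * \<eta> < 1"
    and ed: "\<And>x y. x \<in> X \<Longrightarrow> y \<in> X \<Longrightarrow> e x y \<le> d x y"
    and A: "0 \<le> A" "\<And>x. x \<in> X \<Longrightarrow> \<bar>g x\<bar> \<le> A"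
    and R: "\<And>x. x \<in> X \<Longrightarrow> g x \<noteq> 0 \<Longrightarrow> d a x < R"
  obtains u where "u \<in> Metric_space.LIP X e"
    "\<And>x. x \<in> X \<Longrightarrow> A + 1 + R \<le> e a x \<Longrightarrow> u x = 0"
    "\<And>x. x \<in> X \<Longrightarrow> \<bar>u x\<bar> \<le> max 0 (A + 1 + R)"
    "\<And>x. x \<in> K \<Longrightarrow> \<bar>u x - g x\<bar> \<le> 2 * \<tau>"
    "\<And>x. x \<in> X \<Longrightarrow> Metric_space.asymptotic_slope X e u x \<le> 5 * L + \<epsilon> + 1"
    "\<And>x. x \<in> X \<Longrightarrow> A + 1 + R < e a x \<Longrightarrow> Metric_space.asymptotic_slope X e u x \<le> 0"
    "\<And>x. x \<in> K \<Longrightarrow> g x = 0 \<Longrightarrow> Metric_space.asymptotic_slope X e u x \<le> 0"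
    "\<And>x. x \<in> K \<Longrightarrow> g x \<noteq> 0 \<Longrightarrow> Metric_space.asymptotic_slope X e u x
      \<le> Metric_space.Lip_const d g (Metric_space.mball X d x (2 * r)) + \<epsilon>"
proof -
  interpret D: Metric_space X d by fact
  interpret E: Metric_space X e by fact
  have gL: "g \<in> D.LIP" using L unfolding D.LIP_iff by blast
  have aX: "a \<in> X" using a K by blast
  have Kne: "K \<noteq> {}" using a by blast
  have \<eta>0: "0 \<le> \<eta>" using close[OF a a] aX by simp
  have \<tau>0: "0 < \<tau>" using \<tau>(1) \<eta>0 L(1) by (smt (verit) mult_nonneg_nonneg)
  define C where "C = 5 * L + \<epsilon> + 1"
  have C: "0 < C" using L \<epsilon> by (simp add: C_def)
  obtain F where F: "\<And>x y. x \<in> X \<Longrightarrow> y \<in> X \<Longrightarrow> \<bar>F x - F y\<bar> \<le> (5 * L + \<epsilon>) * e x y"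
    "\<And>x. x \<in> K \<Longrightarrow> g x - L * \<eta> \<le> F x" "\<And>x. x \<in> K \<Longrightarrow> F x \<le> g x"
    "\<And>x. x \<in> K \<Longrightarrow> \<exists>\<delta>>0. \<forall>y\<in>E.mball x \<delta>. \<forall>z\<in>E.mball x \<delta>.
      \<bar>F y - F z\<bar> \<le> (D.Lip_const g (D.mball x (2 * r)) + \<epsilon>) * e y z"
    using localized_mcshane_extension[OF assms(1,2) L K Kne close r \<epsilon> \<eta>] by blast
  have FC: "\<bar>F x - F y\<bar> \<le> C * e x y" if "x \<in> X" "y \<in> X" for x y
    using F(1)[OF that] E.nonneg[of x y] unfolding C_def distrib_right by linarith
  have gF: "\<bar>F x - g x\<bar> \<le> L * \<eta>" if "x \<in> K" for x
    using F(2,3)[OF that] by linarith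
  define w where "w = (\<lambda>x. max 0 (A + 1 + R - e a x))"
  define T where "T = (\<lambda>s. s - max (- \<tau>) (min \<tau> s))"
  define u where "u = (\<lambda>x. max (- w x) (min (w x) (T (F x))))"
  have T_contract: "\<bar>T s - T t\<bar> \<le> \<bar>s - t\<bar>" for s t
    unfolding T_def using \<tau>0 by linarith
  have w_Lip: "\<bar>w x - w y\<bar> \<le> e x y" if "x \<in> X" "y \<in> X" for x y
    unfolding w_def using E.mdist_reverse_triangle[of x a y] that aX
    by (simp add: E.commute[of a])
  have u_diff: "\<bar>u x - u y\<bar> \<le> max \<bar>w x - w y\<bar> \<bar>F x - F y\<bar>" for x y
    using T_contract[of "F x" "F y"] unfolding u_def by linarith
  have u_Lip: "\<bar>u x - u y\<bar> \<le> C * e x y" if "x \<in> X" "y \<in> X" for x y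
  proof -
    have "1 * e x y \<le> C * e x y" using L \<epsilon> by (intro mult_right_mono) (auto simp: C_def)
    then show ?thesis using u_diff[of x y] w_Lip[OF that] FC[OF that] by linarith
  qed
  have uL: "u \<in> E.LIP" by (rule E.LIPI[OF u_Lip])
  have u_zero: "u x = 0" if "A + 1 + R \<le> e a x" for x
    using that by (simp add: u_def w_def)
  have F_cont: "\<bar>F y - F x\<bar> < \<theta>" if "0 < \<theta>" "y \<in> E.mball x (\<theta> / C)" for x y \<theta>
  proof -
    have "e x y < \<theta> / C" "x \<in> X" "y \<in> X" using that by auto
    moreover from this have "C * e x y < \<theta>" using C by (simp add: field_simps)
    ultimately show ?thesis using FC[of x y] by (simp add: abs_minus_commute)
  qed
  show thesis
  proof (rule that[OF uL])
    fix x assume x: "x \<in> X"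
    show "\<bar>u x\<bar> \<le> max 0 (A + 1 + R)"
      using E.nonneg[of a x] unfolding u_def w_def by linarith
    show "E.asymptotic_slope u x \<le> 5 * L + \<epsilon> + 1"
      using C u_Lip by (intro E.asymptotic_slope_le[OF uL, of 1]) (auto simp: C_def)
    assume far: "A + 1 + R < e a x"
    have "u y = 0" if "y \<in> E.mball x (e a x - (A + 1 + R))" for y
      using that E.triangle[of a y x] aX by (intro u_zero) (auto simp: E.commute[of y x])
    then show "E.asymptotic_slope u x \<le> 0"
      using far by (intro E.asymptotic_slope_le[OF uL, of "e a x - (A + 1 + R)"]) auto
  next
    fix x assume x: "x \<in> K" and gx: "g x = 0"
    have "T (F y) = 0" if "y \<in> E.mball x ((\<tau> - L * \<eta>) / C)" for y
      using F_cont[OF _ that] gF[OF x] gx \<tau> \<tau>0 unfolding T_def by linarith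
    then have "u y = 0" if "y \<in> E.mball x ((\<tau> - L * \<eta>) / C)" for y
      using that by (simp add: u_def w_def)
    then show "E.asymptotic_slope u x \<le> 0"
      using \<tau> C by (intro E.asymptotic_slope_le[OF uL, of "(\<tau> - L * \<eta>) / C"]) auto
  next
    fix x assume x: "x \<in> K" and gx: "g x \<noteq> 0"
    have xX: "x \<in> X" using x K by blast
    have near: "e a x < R" using R[OF xX gx] ed[OF aX xX] by simp
    \<comment> \<open>near such \<open>x\<close> the truncation by \<open>w\<close> is inactive\<close>
    define \<delta> where "\<delta> = min (R - e a x) ((1 - L * \<eta>) / C)"
    have \<delta>: "0 < \<delta>" using near \<tau>(2) C by (simp add: \<delta>_def)
    have eq: "u y = T (F y)" if y: "y \<in> E.mball x \<delta>" for y
    proof -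
      have "\<bar>F y - F x\<bar> < 1 - L * \<eta>" using F_cont[of "1 - L * \<eta>" y x] y \<tau>(2) by (auto simp: \<delta>_def)
      then have "\<bar>F y\<bar> < A + 1" using gF[OF x] A(2)[OF xX] by linarith
      moreover have "A + 1 \<le> w y"
        using E.triangle[of a x y] aX y by (auto simp: \<delta>_def w_def)
      moreover have "\<bar>T (F y)\<bar> \<le> \<bar>F y\<bar>" using \<tau>0 unfolding T_def by linarith
      ultimately show ?thesis unfolding u_def by linarith
    qed
    obtain \<delta>' where \<delta>': "0 < \<delta>'" "\<And>y z. y \<in> E.mball x \<delta>' \<Longrightarrow> z \<in> E.mball x \<delta>' \<Longrightarrow>
        \<bar>F y - F z\<bar> \<le> (D.Lip_const g (D.mball x (2 * r)) + \<epsilon>) * e y z"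
      using F(4)[OF x] by blast
    show "E.asymptotic_slope u x \<le> D.Lip_const g (D.mball x (2 * r)) + \<epsilon>"
    proof (rule E.asymptotic_slope_le[OF uL, of "min \<delta> \<delta>'"])
      show "0 \<le> D.Lip_const g (D.mball x (2 * r)) + \<epsilon>"
        using D.Lip_const_nonneg[OF gL D.mball_subset_mspace, of x "2 * r"] \<epsilon> by linarith
      fix y z assume "y \<in> E.mball x (min \<delta> \<delta>')" "z \<in> E.mball x (min \<delta> \<delta>')"
      then have y: "y \<in> E.mball x \<delta>" "y \<in> E.mball x \<delta>'" and z: "z \<in> E.mball x \<delta>" "z \<in> E.mball x \<delta>'"
        by auto
      show "\<bar>u y - u z\<bar> \<le> (D.Lip_const g (D.mball x (2 * r)) + \<epsilon>) * e y z"
        using T_contract[of "F y" "F z"] \<delta>'(2)[OF y(2) z(2)] eq[OF y(1)] eq[OF z(1)] by linarith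
    qed (use \<delta> \<delta>' in auto)
  next
    fix x assume x: "x \<in> K"
    have xX: "x \<in> X" using x K by blast
    show "\<bar>u x - g x\<bar> \<le> 2 * \<tau>"
    proof (cases "g x = 0")
      case True
      have "T (F x) = 0" using gF[OF x] True \<tau> \<tau>0 unfolding T_def by linarith
      then show ?thesis using True \<tau>0 by (simp add: u_def w_def)
    next
      case False
      have "e a x < R" using R[OF xX False] ed[OF aX xX] by simp
      then have "A + 1 \<le> w x" by (simp add: w_def)
      moreover have "\<bar>F x\<bar> \<le> A + 1" using gF[OF x] A(2)[OF xX] \<tau>(2) by linarith
      moreover have "\<bar>T (F x)\<bar> \<le> \<bar>F x\<bar>" "\<bar>T (F x) - F x\<bar> \<le> \<tau>" using \<tau>0 unfolding T_def by linarith+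
      ultimately show ?thesis using gF[OF x] \<tau> unfolding u_def by linarith
    qed
  qed (use u_zero in auto)
qed

section \<open>Recovery sequences\<close>

text \<open>
  Separability and continuity of the measure from above: countably many balls of the given radius
  cover the space, so finitely many cover \<open>B\<close> up to small measure.
\<close>

lemma (in metric_measure_space) finite_ball_cover:
  assumes B: "B \<in> sets m" "emeasure m B < \<infinity>" and s: "0 < s" and \<kappa>: "0 < \<kappa>"
  obtains Z where "finite Z" "Z \<subseteq> X" "emeasure m (B - (\<Union>z\<in>Z. mball z s)) < \<kappa>"
proof -
  obtain C where C: "countable C" "C \<subseteq> X" "mtopology closure_of C = X"
    using separable unfolding separable_space_def by auto
  show thesis
  proof (cases "C = {}")
    case True
    then have "X = {}" using C(3) by simp
    then have "B = {}" using sets.sets_into_space[OF B(1)] space_m by blast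
    then show ?thesis using that[of "{}"] \<kappa> by simp
  next
    case False
    define c where "c = from_nat_into C"
    have c: "range c = C" unfolding c_def by (rule range_from_nat_into[OF False C(1)])
    define W where "W = (\<lambda>n::nat. B - (\<Union>k<n. mball (c k) s))"
    have sets: "range W \<subseteq> sets m"
      unfolding W_def using B(1) openin_sets[OF openin_mball] by auto
    have "decseq W" unfolding W_def decseq_def by fastforce
    moreover have "emeasure m (W n) \<noteq> \<infinity>" for n
      using emeasure_mono[of "W n" B m] B by (auto simp: W_def top_unique)
    ultimately have "(\<lambda>n. emeasure m (W n)) \<longlonglongrightarrow> emeasure m (\<Inter>n. W n)"
      using sets by (intro Lim_emeasure_decseq) auto
    moreover have "(\<Inter>n. W n) = {}"
    proof -
      have "x \<notin> (\<Inter>n. W n)" for x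
      proof
        assume x: "x \<in> (\<Inter>n. W n)"
        then have "x \<in> B" by (auto simp: W_def)
        then have xX: "x \<in> X" using sets.sets_into_space[OF B(1)] space_m by blast
        then obtain y where "y \<in> C" "y \<in> mball x s"
          using C(3) s unfolding metric_closure_of by blast
        moreover from this obtain k where "c k = y" using c by blast
        ultimately have "x \<in> mball (c k) s" by (auto simp: commute)
        moreover have "x \<in> W (Suc k)" using x by blast
        ultimately show False by (auto simp: W_def)
      qed
      then show ?thesis by blast
    qed
    ultimately have "(\<lambda>n. emeasure m (W n)) \<longlonglongrightarrow> 0" by simp
    then have "\<forall>\<^sub>F n in sequentially. emeasure m (W n) < \<kappa>" using \<kappa> by (rule order_tendstoD)
    then obtain n where n: "emeasure m (W n) < \<kappa>" using eventually_happens'[OF sequentially_bot] by blast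
    have "W n = B - (\<Union>z\<in>c ` {..<n}. mball z s)" by (simp add: W_def)
    moreover have "c ` {..<n} \<subseteq> X" using c C(2) by blast
    ultimately show ?thesis using that[of "c ` {..<n}"] n by simp
  qed
qed

text \<open>
  The index \<open>\<nu> i\<close> is the largest \<open>n \<le> i\<close> whose threshold has been passed at \<open>i\<close>.
\<close>

lemma eventually_diagonal:
  fixes Q :: "nat \<Rightarrow> nat \<Rightarrow> bool"
  assumes "\<And>n. \<forall>\<^sub>F i in sequentially. Q n i"
  obtains \<nu> :: "nat \<Rightarrow> nat"
  where "filterlim \<nu> at_top sequentially" "\<forall>\<^sub>F i in sequentially. Q (\<nu> i) i"
proof -
  obtain N where N: "\<And>n i. N n \<le> i \<Longrightarrow> Q n i"
    using assms unfolding eventually_sequentially by metis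
  define \<nu> where "\<nu> = (\<lambda>i. Max (insert 0 {n. n \<le> i \<and> N n \<le> i}))"
  have fin: "finite (insert 0 {n. n \<le> i \<and> N n \<le> i})" for i by simp
  have "\<forall>\<^sub>F i in sequentially. k \<le> \<nu> i" for k
    unfolding eventually_sequentially
  proof (intro exI[of _ "max k (N k)"] allI impI)
    fix i assume "max k (N k) \<le> i"
    then show "k \<le> \<nu> i" unfolding \<nu>_def by (intro Max_ge[OF fin]) auto
  qed
  then have "filterlim \<nu> at_top sequentially" unfolding filterlim_at_top by blast
  moreover have "\<forall>\<^sub>F i in sequentially. Q (\<nu> i) i"
    unfolding eventually_sequentially
  proof (intro exI[of _ "N 0"] allI impI)
    fix i assume "N 0 \<le> i"
    moreover have "\<nu> i \<in> insert 0 {n. n \<le> i \<and> N n \<le> i}"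
      unfolding \<nu>_def by (rule Max_in[OF fin]) simp
    ultimately show "Q (\<nu> i) i" by (intro N) auto
  qed
  ultimately show thesis using that by blast
qed

context metrics_increasing_to
begin

text \<open>
  Pointwise convergence on the finitely many pairs of centres is uniform, and the triangle inequality
  passes it on to the balls, because the distances \<open>d\<^sub>i\<close> between a point and its centre are below \<open>d\<close>.
\<close>

lemma eventually_uniformly_close:
  assumes Z: "finite Z" "Z \<subseteq> X" and \<eta>: "0 < \<eta>"
  shows "\<forall>\<^sub>F i in sequentially. \<forall>x\<in>(\<Union>z\<in>Z. D.mball z (\<eta> / 8)). \<forall>y\<in>(\<Union>z\<in>Z. D.mball z (\<eta> / 8)).
    d x y \<le> di i x y + \<eta>"
proof -
  have "\<forall>\<^sub>F i in sequentially. \<forall>z\<in>Z. \<forall>w\<in>Z. d z w - \<eta> / 4 < di i z w"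
  proof (intro eventually_ball_finite ballI Z(1))
    fix z w assume "z \<in> Z" "w \<in> Z"
    then show "\<forall>\<^sub>F i in sequentially. d z w - \<eta> / 4 < di i z w"
      using lim[of z w] Z(2) \<eta> by (intro order_tendstoD(1)) auto
  qed
  then show ?thesis
  proof eventually_elim
    case (elim i)
    interpret E: metric_measure_space X "di i" m by (rule mms)
    show ?case
    proof (intro ballI)
      fix x y assume "x \<in> (\<Union>z\<in>Z. D.mball z (\<eta> / 8))" "y \<in> (\<Union>z\<in>Z. D.mball z (\<eta> / 8))"
      then obtain z w where zw: "z \<in> Z" "x \<in> D.mball z (\<eta> / 8)" "w \<in> Z" "y \<in> D.mball w (\<eta> / 8)"
        by blast
      then have X: "x \<in> X" "y \<in> X" "z \<in> X" "w \<in> X" and near: "d z x < \<eta> / 8" "d w y < \<eta> / 8"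
        using Z(2) by auto
      \<comment> \<open>four distances to centres and the error on the pair of centres: \<open>4 * (\<eta> / 8) + \<eta> / 4 < \<eta>\<close>\<close>
      have "d x y \<le> d z x + d z w + d w y"
        using D.triangle[OF X(1,3,2)] D.triangle[OF X(3,4,2)] by (simp add: D.commute[of x z])
      moreover have "di i z w \<le> di i z x + di i x y + di i w y"
        using E.triangle[OF X(3,1,4)] E.triangle[OF X(1,2,4)] by (simp add: E.commute[of y w])
      moreover have "d z w - \<eta> / 4 < di i z w" using elim zw by blast
      ultimately show "d x y \<le> di i x y + \<eta>"
        using near di_le_d[OF X(3,1), of i] di_le_d[OF X(4,2), of i] \<eta> by linarith
    qed
  qed
qed

text \<open>
  The order of choices matters: \<open>r\<close>, \<open>\<epsilon>\<close>, \<open>\<tau>\<close> and hence the permitted error \<open>\<eta>\<close> between the distances come first, then \<open>K\<close>,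
  which misses only measure \<open>\<kappa>\<close> of the ball \<open>B\<close>, and last the index \<open>i\<close>. Points off \<open>K\<close> contribute a
  constant multiple of \<open>\<kappa>\<close>, with a constant that does not depend on these choices as long as
  \<open>\<epsilon>\<close> stays bounded. The ball \<open>B\<close> is taken with respect to \<open>di 0\<close> because it must contain the supports of all
  approximants and still have finite measure.
\<close>

lemma eventually_recovery_quantitative:
  assumes a: "a \<in> X"
    and L: "0 < L" "\<And>x y. x \<in> X \<Longrightarrow> y \<in> X \<Longrightarrow> \<bar>g x - g y\<bar> \<le> L * d x y"
    and A: "0 \<le> A" "\<And>x. x \<in> X \<Longrightarrow> \<bar>g x\<bar> \<le> A"
    and R: "0 < R" "\<And>x. x \<in> X \<Longrightarrow> g x \<noteq> 0 \<Longrightarrow> d a x < R"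
    and pos: "0 < r" "0 < \<epsilon>" "0 < \<tau>" "0 < \<kappa>"
  shows "\<forall>\<^sub>F i in sequentially. \<exists>u\<in>Lp m p.
    Metric_space.asymptotic_energy X (di i) m p u \<le> ennreal (1 / p) *
      ((\<integral>\<^sup>+x. ennreal ((D.Lip_const g (D.mball x (2 * r)) + \<epsilon>) powr p) * indicator {x \<in> X. g x \<noteq> 0} x \<partial>m)
        + ennreal ((5 * L + \<epsilon> + 1) powr p * \<kappa>)) \<and>
    (LINT x|m. \<bar>u x - g x\<bar> powr p) \<le>
      (2 * \<tau>) powr p * measure m {x \<in> X. di 0 a x \<le> A + 1 + R} + (2 * A + 1 + R) powr p * \<kappa>"
proof -
  interpret E0: metric_measure_space X "di 0" m by (rule mms)
  have gL: "g \<in> D.LIP" using L unfolding D.LIP_iff by blast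
  \<comment> \<open>the four terms meet the four smallness conditions of the truncated extension\<close>
  define \<eta> where "\<eta> = min (min (r / 4) (\<epsilon> * r / (8 * L))) (min (\<tau> / (2 * L)) (1 / (2 * L)))"
  have \<eta>: "0 < \<eta>" "\<eta> \<le> r / 4" "L * \<eta> \<le> \<epsilon> * r / 8" "L * \<eta> < \<tau>" "L * \<eta> < 1"
  proof -
    show "0 < \<eta>" "\<eta> \<le> r / 4" using pos L by (auto simp: \<eta>_def)
    have "L * \<eta> \<le> L * (\<epsilon> * r / (8 * L))" "L * \<eta> \<le> L * (\<tau> / (2 * L))" "L * \<eta> \<le> L * (1 / (2 * L))"
      using L by (intro mult_left_mono; simp add: \<eta>_def)+
    then have "L * \<eta> \<le> \<epsilon> * r / 8" "L * \<eta> \<le> \<tau> / 2" "L * \<eta> \<le> 1 / 2" using L by auto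
    then show "L * \<eta> \<le> \<epsilon> * r / 8" "L * \<eta> < \<tau>" "L * \<eta> < 1" using pos by auto
  qed
  define B where "B = {x \<in> X. di 0 a x \<le> A + 1 + R}"
  have B_ball: "B = E0.mcball a (A + 1 + R)" using a by (auto simp: B_def)
  have Bsets: "B \<in> sets m" unfolding B_ball by (intro E0.closedin_sets E0.closedin_mcball)
  have Bfin: "emeasure m B < \<infinity>"
    using E0.boundedly_finite Bsets E0.mbounded_mcball unfolding E0.boundedly_finite_def B_ball by blast
  obtain Z where Z: "finite Z" "Z \<subseteq> X" "emeasure m (B - (\<Union>z\<in>Z. D.mball z (\<eta> / 8))) < ennreal \<kappa>"
    using D.finite_ball_cover[OF Bsets Bfin, of "\<eta> / 8" "ennreal \<kappa>"] \<eta>(1) pos(4) by auto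
  define U where "U = (\<Union>z\<in>insert a Z. D.mball z (\<eta> / 8))"
  \<comment> \<open>the centre \<open>a\<close> is added to the cover so that \<open>K\<close> contains it\<close>
  define K where "K = B \<inter> U"
  have "openin D.mtopology U" unfolding U_def by (intro openin_Union) auto
  then have Ksets: "K \<in> sets m" unfolding K_def using Bsets D.openin_sets by blast
  have KX: "K \<subseteq> X" by (auto simp: K_def B_def)
  have aK: "a \<in> K" using a \<eta>(1) A(1) R(1) by (auto simp: K_def B_def U_def)
  have BK: "emeasure m (B - K) \<le> ennreal \<kappa>"
  proof -
    have "emeasure m (B - K) \<le> emeasure m (B - (\<Union>z\<in>Z. D.mball z (\<eta> / 8)))"
      using Bsets D.openin_sets[OF openin_Union, of "(\<lambda>z. D.mball z (\<eta> / 8)) ` Z"]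
      by (intro emeasure_mono) (auto simp: K_def U_def)
    then show ?thesis using Z(3) by simp
  qed
  have BKsets: "B - K \<in> sets m" using Bsets Ksets by blast
  define G where "G = {x \<in> X. g x \<noteq> 0}"
  have Gsets: "G \<in> sets m"
  proof -
    have "{x \<in> space m. g x \<noteq> 0} \<in> sets m"
      using D.LIP_borel_measurable[OF gL] by measurable
    then show ?thesis by (simp add: G_def D.space_m)
  qed
  have "\<forall>\<^sub>F i in sequentially. \<forall>x\<in>U. \<forall>y\<in>U. d x y \<le> di i x y + \<eta>"
    unfolding U_def using Z a \<eta>(1) by (intro eventually_uniformly_close) auto
  then show ?thesis
  proof eventually_elim
    case (elim i)
    interpret E: metric_measure_space X "di i" m by (rule mms)
    obtain u where u: "u \<in> E.LIP"
      "\<And>x. x \<in> X \<Longrightarrow> A + 1 + R \<le> di i a x \<Longrightarrow> u x = 0"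
      "\<And>x. x \<in> X \<Longrightarrow> \<bar>u x\<bar> \<le> max 0 (A + 1 + R)"
      "\<And>x. x \<in> K \<Longrightarrow> \<bar>u x - g x\<bar> \<le> 2 * \<tau>"
      "\<And>x. x \<in> X \<Longrightarrow> E.asymptotic_slope u x \<le> 5 * L + \<epsilon> + 1"
      "\<And>x. x \<in> X \<Longrightarrow> A + 1 + R < di i a x \<Longrightarrow> E.asymptotic_slope u x \<le> 0"
      "\<And>x. x \<in> K \<Longrightarrow> g x = 0 \<Longrightarrow> E.asymptotic_slope u x \<le> 0"
      "\<And>x. x \<in> K \<Longrightarrow> g x \<noteq> 0 \<Longrightarrow> E.asymptotic_slope u x \<le> D.Lip_const g (D.mball x (2 * r)) + \<epsilon>"
    proof (rule truncated_mcshane_extension[OF D.Metric_space_axioms E.Metric_space_axioms L KX aK _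
          pos(1,2) \<eta>(2-5) di_le_d A R(2)])
      fix x y assume "x \<in> K" "y \<in> K"
      then show "d x y \<le> di i x y + \<eta>" using elim by (auto simp: K_def)
    qed blast+
    have off_B: "A + 1 + R < di i a x" if "x \<in> X" "x \<notin> B" for x
      using that di_0_le_di[OF a that(1), of i] by (auto simp: B_def)
    have u_bound: "\<bar>u x\<bar> \<le> A + 1 + R" if "x \<in> X" for x
      using u(3)[OF that] A(1) R(1) by simp
    have slope0: "0 \<le> E.asymptotic_slope u x" for x by (rule E.asymptotic_slope_nonneg[OF u(1)])
    have uB: "E.boundedly_supported u"
      unfolding E.boundedly_supported_iff_ball[OF a]
      using u(2) A(1) R(1) by (intro exI[of _ "A + 1 + R"]) force
    note [measurable] = E.LIP_borel_measurable[OF u(1)] D.LIP_borel_measurable[OF gL]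
      D.Lip_const_ball_borel_measurable[OF gL] Bsets Ksets BKsets Gsets
    have "integrable m (\<lambda>x. \<bar>u x\<bar> powr p)"
    proof (rule Bochner_Integration.integrable_bound)
      show "integrable m (\<lambda>x. (A + 1 + R) powr p * indicator B x)"
        using Bfin by (simp add: integrable_real_mult_indicator integrable_mult_right)
      have "\<bar>u x\<bar> powr p \<le> (A + 1 + R) powr p * indicator B x" if "x \<in> space m" for x
        using that u_bound[of x] u(2)[of x] off_B[of x] p
        by (cases "x \<in> B") (auto simp: D.space_m powr_mono2)
      then show "AE x in m. norm (\<bar>u x\<bar> powr p) \<le> norm ((A + 1 + R) powr p * indicator B x)"
        by (intro AE_I2) simp
    qed simp
    then have uLp: "u \<in> Lp m p" by (simp add: Lp_def)
    have "(\<integral>\<^sup>+x. ennreal (E.asymptotic_slope u x powr p) \<partial>m)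
        \<le> (\<integral>\<^sup>+x. ennreal ((D.Lip_const g (D.mball x (2 * r)) + \<epsilon>) powr p) * indicator G x
            + ennreal ((5 * L + \<epsilon> + 1) powr p) * indicator (B - K) x \<partial>m)"
    proof (rule nn_integral_mono)
      fix x assume "x \<in> space m"
      then have x: "x \<in> X" by (simp add: D.space_m)
      have powr_le: "ennreal (E.asymptotic_slope u x powr p) \<le> ennreal (b powr p)"
        if "E.asymptotic_slope u x \<le> b" for b
        using that slope0[of x] p by (intro ennreal_leI powr_mono2) auto
      consider "x \<in> K" "g x = 0" | "x \<in> K" "g x \<noteq> 0" | "x \<notin> K" "x \<in> B" | "x \<notin> B" by blast
      then show "ennreal (E.asymptotic_slope u x powr p)
        \<le> ennreal ((D.Lip_const g (D.mball x (2 * r)) + \<epsilon>) powr p) * indicator G x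
            + ennreal ((5 * L + \<epsilon> + 1) powr p) * indicator (B - K) x"
      proof cases
        case 1 then show ?thesis using powr_le[OF u(7)] p by auto
      next
        case 2 then show ?thesis using powr_le[OF u(8)] x by (simp add: G_def add_increasing2)
      next
        case 3 then show ?thesis using powr_le[OF u(5)[OF x]] by (simp add: add_increasing)
      next
        case 4 then show ?thesis using powr_le[OF u(6)[OF x off_B[OF x]]] p by auto
      qed
    qed
    also have "\<dots> = (\<integral>\<^sup>+x. ennreal ((D.Lip_const g (D.mball x (2 * r)) + \<epsilon>) powr p) * indicator G x \<partial>m)
            + ennreal ((5 * L + \<epsilon> + 1) powr p) * emeasure m (B - K)"
      by (simp add: nn_integral_add nn_integral_cmult_indicator)
    also have "\<dots> \<le> (\<integral>\<^sup>+x. ennreal ((D.Lip_const g (D.mball x (2 * r)) + \<epsilon>) powr p) * indicator G x \<partial>m)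
            + ennreal ((5 * L + \<epsilon> + 1) powr p * \<kappa>)"
      using BK pos(4) by (auto simp: ennreal_mult intro!: add_left_mono mult_left_mono)
    finally have energy: "E.asymptotic_energy m p u \<le> ennreal (1 / p) *
        ((\<integral>\<^sup>+x. ennreal ((D.Lip_const g (D.mball x (2 * r)) + \<epsilon>) powr p) * indicator G x \<partial>m)
          + ennreal ((5 * L + \<epsilon> + 1) powr p * \<kappa>))"
      unfolding E.asymptotic_energy_def using u(1) uB by (auto intro: mult_left_mono)
    have BKfin: "emeasure m (B - K) < \<infinity>"
      using le_less_trans[OF BK ennreal_less_top] by simp
    have "(LINT x|m. \<bar>u x - g x\<bar> powr p)
        \<le> (LINT x|m. (2 * \<tau>) powr p * indicator B x + (2 * A + 1 + R) powr p * indicator (B - K) x)"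
    proof (rule integral_mono')
      show "integrable m (\<lambda>x. (2 * \<tau>) powr p * indicator B x + (2 * A + 1 + R) powr p * indicator (B - K) x)"
        using Bfin BKfin by (intro Bochner_Integration.integrable_add integrable_mult_right
            integrable_real_indicator) auto
      fix x assume "x \<in> space m"
      then have x: "x \<in> X" by (simp add: D.space_m)
      consider "x \<in> K" "x \<in> B" | "x \<notin> K" "x \<in> B" | "x \<notin> B" "x \<notin> K" by (auto simp: K_def)
      then show "\<bar>u x - g x\<bar> powr p
          \<le> (2 * \<tau>) powr p * indicator B x + (2 * A + 1 + R) powr p * indicator (B - K) x"
      proof cases
        case 1 then show ?thesis using u(4) p by (simp add: powr_mono2)
      next
        case 2
        have "\<bar>u x - g x\<bar> \<le> 2 * A + 1 + R" using u_bound[OF x] A(2)[OF x] by linarith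
        then have "\<bar>u x - g x\<bar> powr p \<le> (2 * A + 1 + R) powr p" using p by (intro powr_mono2) auto
        then show ?thesis using 2 by (simp add: add_increasing)
      next
        case 3
        have far: "A + 1 + R < di i a x" by (rule off_B[OF x 3(1)])
        then have "g x = 0" using R(2)[OF x] di_le_d[OF a x, of i] A(1) by fastforce
        then show ?thesis using 3 u(2)[OF x] far p by simp
      qed
    qed simp
    also have "\<dots> = (2 * \<tau>) powr p * measure m B + (2 * A + 1 + R) powr p * measure m (B - K)"
      using Bfin BKfin Bsets BKsets by (subst Bochner_Integration.integral_add) (auto intro!: integrable_mult_right integrable_real_indicator)
    also have "\<dots> \<le> (2 * \<tau>) powr p * measure m B + (2 * A + 1 + R) powr p * \<kappa>"
      using BK pos(4) by (intro add_left_mono mult_left_mono) (auto simp: measure_def enn2real_leI)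
    finally show ?case using uLp energy unfolding B_def G_def by blast
  qed
qed

text \<open>
  All parameters of the quantitative construction are set to \<open>1 / Suc n\<close>; dominated convergence on the support
  of \<open>g\<close> turns the bound into the energy of \<open>g\<close> as \<open>n\<close> grows.
\<close>

lemma eventually_recovery:
  assumes g: "g \<in> Lp m p" "D.asymptotic_energy m p g < c" and e: "0 < e" and a: "a \<in> X"
  shows "\<forall>\<^sub>F i in sequentially. \<exists>u\<in>Lp m p. Lp_norm m p (\<lambda>x. u x - g x) < e \<and>
    Metric_space.asymptotic_energy X (di i) m p u < c"
proof -
  have gL: "g \<in> D.LIP" and gB: "D.boundedly_supported g"
    using D.asymptotic_energy_lessD[OF g(2)] by auto
  obtain L where L: "0 < L" "\<And>x y. x \<in> X \<Longrightarrow> y \<in> X \<Longrightarrow> \<bar>g x - g y\<bar> \<le> L * d x y"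
    using gL unfolding D.LIP_iff by blast
  obtain A where A: "0 \<le> A" "\<And>x. x \<in> X \<Longrightarrow> \<bar>g x\<bar> \<le> A"
    using D.LIP_boundedly_supported_bounded[OF gL gB] by blast
  obtain R where R: "0 < R" "\<And>x. x \<in> X \<Longrightarrow> g x \<noteq> 0 \<Longrightarrow> d a x < R"
    using gB unfolding D.boundedly_supported_iff_ball[OF a] by blast
  define G where "G = {x \<in> X. g x \<noteq> 0}"
  note [measurable] = D.LIP_borel_measurable[OF gL] D.Lip_const_ball_borel_measurable[OF gL]
    D.asymptotic_slope_borel_measurable[OF gL]
  have Gsets: "G \<in> sets m"
  proof -
    have "{x \<in> space m. g x \<noteq> 0} \<in> sets m" by measurable
    then show ?thesis by (simp add: G_def D.space_m)
  qed
  have Gfin: "emeasure m G < \<infinity>"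
    using D.boundedly_finite Gsets gB unfolding D.boundedly_finite_def D.boundedly_supported_iff G_def by blast
  define s where "s = (\<lambda>n. inverse (real (Suc n)))"
  have s: "0 < s n" "s n \<le> 1" for n by (auto simp: s_def field_simps)
  have slim: "s \<longlonglongrightarrow> 0" unfolding s_def by (rule LIMSEQ_inverse_real_of_nat)
  define I where "I = (\<lambda>n. \<integral>\<^sup>+x. ennreal ((D.Lip_const g (D.mball x (2 * s n)) + s n) powr p) * indicator G x \<partial>m)"
  define J where "J = (\<lambda>n. ennreal (1 / p) * (I n + ennreal ((5 * L + s n + 1) powr p * s n)))"
  define N where "N = (\<lambda>n. (2 * s n) powr p * measure m {x \<in> X. di 0 a x \<le> A + 1 + R}
      + (2 * A + 1 + R) powr p * s n)"
  have "I \<longlonglongrightarrow> (\<integral>\<^sup>+x. ennreal (D.asymptotic_slope g x powr p) * indicator G x \<partial>m)"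
    unfolding I_def
  proof (rule nn_integral_powr_on_finite_tendsto[where C = "L + 1"])
    fix x n
    show "0 \<le> D.Lip_const g (D.mball x (2 * s n)) + s n"
      using D.Lip_const_nonneg[OF gL D.mball_subset_mspace, of x "2 * s n"] s(1)[of n] by linarith
    have "D.Lip_const g (D.mball x (2 * s n)) \<le> L"
      using L by (intro D.Lip_const_le) auto
    then show "D.Lip_const g (D.mball x (2 * s n)) + s n \<le> L + 1" using s(2)[of n] by linarith
    have "(\<lambda>n. 2 * s n) \<longlonglongrightarrow> 2 * 0" by (intro tendsto_intros slim)
    then have "(\<lambda>n. D.Lip_const g (D.mball x (2 * s n))) \<longlonglongrightarrow> D.asymptotic_slope g x"
      using s(1) by (intro D.Lip_const_ball_tendsto_asymptotic_slope[OF gL]) auto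
    then have "(\<lambda>n. D.Lip_const g (D.mball x (2 * s n)) + s n) \<longlonglongrightarrow> D.asymptotic_slope g x + 0"
      by (intro tendsto_add slim)
    then show "(\<lambda>n. D.Lip_const g (D.mball x (2 * s n)) + s n) \<longlonglongrightarrow> D.asymptotic_slope g x" by simp
  qed (use p Gsets Gfin in auto)
  moreover have "(\<lambda>n. ennreal ((5 * L + s n + 1) powr p * s n)) \<longlonglongrightarrow> ennreal ((5 * L + 0 + 1) powr p * 0)"
    using L by (intro tendsto_ennrealI tendsto_intros slim) auto
  ultimately have "J \<longlonglongrightarrow> ennreal (1 / p) *
      ((\<integral>\<^sup>+x. ennreal (D.asymptotic_slope g x powr p) * indicator G x \<partial>m) + ennreal ((5 * L + 0 + 1) powr p * 0))"
    unfolding J_def by (intro ennreal_tendsto_cmult tendsto_add) auto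
  moreover have "ennreal (1 / p) *
      ((\<integral>\<^sup>+x. ennreal (D.asymptotic_slope g x powr p) * indicator G x \<partial>m) + ennreal ((5 * L + 0 + 1) powr p * 0)) < c"
  proof -
    have "ennreal (1 / p) * (\<integral>\<^sup>+x. ennreal (D.asymptotic_slope g x powr p) * indicator G x \<partial>m)
        \<le> D.asymptotic_energy m p g"
      using gL gB unfolding D.asymptotic_energy_def
      by (auto intro!: mult_left_mono nn_integral_mono split: split_indicator)
    then show ?thesis using g(2) by simp
  qed
  ultimately have evJ: "\<forall>\<^sub>F n in sequentially. J n < c" by (rule order_tendstoD)
  have "(\<lambda>n. (2 * s n) powr p) \<longlonglongrightarrow> 0"
    using p s(1) tendsto_mult_right_zero[OF slim, of 2]
    by (intro tendsto_zero_powrI[OF _ tendsto_const]) (auto intro!: always_eventually less_imp_le)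
  then have "N \<longlonglongrightarrow> 0 * measure m {x \<in> X. di 0 a x \<le> A + 1 + R} + (2 * A + 1 + R) powr p * 0"
    unfolding N_def by (intro tendsto_intros slim)
  then have "\<forall>\<^sub>F n in sequentially. N n < (e / 2) powr p"
    using e by (intro order_tendstoD) auto
  with evJ have "\<forall>\<^sub>F n in sequentially. J n < c \<and> N n < (e / 2) powr p" by (rule eventually_conj)
  then obtain n where n: "J n < c" "N n < (e / 2) powr p"
    using eventually_happens'[OF sequentially_bot] by blast
  have "\<forall>\<^sub>F i in sequentially. \<exists>u\<in>Lp m p. Metric_space.asymptotic_energy X (di i) m p u \<le> J n \<and>
      (LINT x|m. \<bar>u x - g x\<bar> powr p) \<le> N n"
    unfolding J_def I_def N_def G_def
    by (rule eventually_recovery_quantitative[OF a L(1) _ A(1) _ R(1)]) (use L A R s in auto)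
  then show ?thesis
  proof eventually_elim
    case (elim i)
    then obtain u where u: "u \<in> Lp m p" "Metric_space.asymptotic_energy X (di i) m p u \<le> J n"
      "(LINT x|m. \<bar>u x - g x\<bar> powr p) \<le> N n"
      by blast
    have "Lp_norm m p (\<lambda>x. u x - g x) \<le> e / 2"
      using u(3) n(2) e p by (subst Lp_norm_le_iff) auto
    then show ?case using u n(1) e by (intro bexI[of _ u]) auto
  qed
qed

text \<open>
  Functions that almost realize the Cheeger energy of \<open>f\<close> are recovered for all large \<open>i\<close> with any given
  accuracy \<open>s n\<close>; the diagonal index \<open>\<nu> i\<close> lets the accuracy improve with \<open>i\<close>.
\<close>

lemma Cheeger_energy_limsup:
  assumes f: "f \<in> Lp m p"
  obtains fs where "Lp_converges m p fs f"
    "limsup (\<lambda>i. Metric_space.Cheeger_energy X (di i) m p (fs i)) \<le> D.Cheeger_energy m p f"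
proof -
  have p1: "1 \<le> p" using p by simp
  have const: "Lp_converges m p (\<lambda>_. f) f" using f by (simp add: Lp_converges_def Lp_norm_def)
  define c where "c = D.Cheeger_energy m p f"
  consider "X = {}" | "c = \<infinity>" | a where "a \<in> X" "c < \<infinity>"
    by (metis ex_in_conv infinity_ennreal_def less_top)
  then show thesis
  proof cases
    case 1
    have "Metric_space.Cheeger_energy X (di i) m p f \<le> 0" for i
      using metric_measure_space.Cheeger_energy_le_asymptotic_energy[OF mms f, of i]
      by (simp add: metric_measure_space.asymptotic_energy_empty[OF mms 1])
    then show thesis
      by (intro that[OF const]) (simp add: Limsup_const)
  next
    case 2
    then show thesis using that[OF const] by (simp add: c_def)
  next
    case 3
    define s where "s = (\<lambda>n. inverse (real (Suc n)))"
    have s: "0 < s n" for n by (simp add: s_def)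
    have slim: "s \<longlonglongrightarrow> 0" unfolding s_def by (rule LIMSEQ_inverse_real_of_nat)
    define Q where "Q = (\<lambda>n i. \<exists>u\<in>Lp m p. Lp_norm m p (\<lambda>x. u x - f x) < s n \<and>
      Metric_space.asymptotic_energy X (di i) m p u < c + ennreal (s n))"
    have "\<forall>\<^sub>F i in sequentially. Q n i" for n
    proof -
      have "c + 0 < c + ennreal (s n)"
        using 3(2) s[of n] by (intro ennreal_add_left_cancel_less[THEN iffD2]) auto
      then obtain g where g: "g \<in> Lp m p" "Lp_norm m p (\<lambda>x. g x - f x) < s n / 2"
        "D.asymptotic_energy m p g < c + ennreal (s n)"
        using D.Cheeger_energy_less_approx[of p f "c + ennreal (s n)" "s n / 2"] s[of n]
        by (auto simp: c_def)
      have "\<forall>\<^sub>F i in sequentially. \<exists>u\<in>Lp m p. Lp_norm m p (\<lambda>x. u x - g x) < s n / 2 \<and>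
          Metric_space.asymptotic_energy X (di i) m p u < c + ennreal (s n)"
        using eventually_recovery[OF g(1,3) _ 3(1), of "s n / 2"] s[of n] by simp
      then show ?thesis
      proof eventually_elim
        case (elim i)
        then obtain u where u: "u \<in> Lp m p" "Lp_norm m p (\<lambda>x. u x - g x) < s n / 2"
          "Metric_space.asymptotic_energy X (di i) m p u < c + ennreal (s n)" by blast
        have "Lp_norm m p (\<lambda>x. u x - f x) < s n"
          using Lp_norm_diff_triangle[OF p1 u(1) g(1) f] u(2) g(2) by linarith
        then show ?case using u unfolding Q_def by blast
      qed
    qed
    then obtain \<nu> where \<nu>: "filterlim \<nu> at_top sequentially" "\<forall>\<^sub>F i in sequentially. Q (\<nu> i) i"
      by (rule eventually_diagonal)
    have s\<nu>: "(\<lambda>i. s (\<nu> i)) \<longlonglongrightarrow> 0" by (rule filterlim_compose[OF slim \<nu>(1)])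
    define P where "P = (\<lambda>i u. u \<in> Lp m p \<and> (Q (\<nu> i) i \<longrightarrow> Lp_norm m p (\<lambda>x. u x - f x) < s (\<nu> i) \<and>
      Metric_space.asymptotic_energy X (di i) m p u < c + ennreal (s (\<nu> i))))"
    have "\<exists>u. P i u" for i
      using f unfolding P_def Q_def by blast
    then obtain fs where "\<And>i. P i (fs i)" by metis
    then have fs: "\<And>i. fs i \<in> Lp m p" "\<And>i. Q (\<nu> i) i \<Longrightarrow> Lp_norm m p (\<lambda>x. fs i x - f x) < s (\<nu> i)"
      "\<And>i. Q (\<nu> i) i \<Longrightarrow> Metric_space.asymptotic_energy X (di i) m p (fs i) < c + ennreal (s (\<nu> i))"
      unfolding P_def by blast+
    have "(\<lambda>i. Lp_norm m p (\<lambda>x. fs i x - f x)) \<longlonglongrightarrow> 0"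
    proof (rule tendsto_sandwich[OF _ _ tendsto_const s\<nu>])
      show "\<forall>\<^sub>F i in sequentially. Lp_norm m p (\<lambda>x. fs i x - f x) \<le> s (\<nu> i)"
        using \<nu>(2) by eventually_elim (use fs(2) less_imp_le in blast)
    qed (simp add: Lp_norm_nonneg)
    then have conv: "Lp_converges m p fs f" using fs(1) f by (simp add: Lp_converges_def)
    have "limsup (\<lambda>i. Metric_space.Cheeger_energy X (di i) m p (fs i)) \<le> limsup (\<lambda>i. c + ennreal (s (\<nu> i)))"
    proof (rule Limsup_mono)
      show "\<forall>\<^sub>F i in sequentially. Metric_space.Cheeger_energy X (di i) m p (fs i) \<le> c + ennreal (s (\<nu> i))"
        using \<nu>(2)
      proof eventually_elim
        case (elim i)
        then show ?case
          using metric_measure_space.Cheeger_energy_le_asymptotic_energy[OF mms fs(1), of i i] fs(3)[of i]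
          by (meson less_imp_le order_trans)
      qed
    qed
    also have "\<dots> = c"
    proof (rule lim_imp_Limsup)
      have "(\<lambda>i. c + ennreal (s (\<nu> i))) \<longlonglongrightarrow> c + ennreal 0"
        by (intro tendsto_add tendsto_const tendsto_ennrealI s\<nu>)
      then show "(\<lambda>i. c + ennreal (s (\<nu> i))) \<longlonglongrightarrow> c" by simp
    qed simp
    finally show thesis using that[OF conv] by (simp add: c_def)
  qed
qed

end

section \<open>Mosco convergence\<close>

theorem theorem4p1:
  fixes X :: "'a set"
    and d :: "'a \<Rightarrow> 'a \<Rightarrow> real"
    and m :: "'a measure"
    and di :: "nat \<Rightarrow> 'a \<Rightarrow> 'a \<Rightarrow> real"
    and p :: real
  assumes "metric_measure_space X d m"
    and "\<And>i. Metric_space X (di i)"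
    and "\<And>i. Metric_space.mcomplete X (di i)"
    and "\<And>i x y. x \<in> X \<Longrightarrow> y \<in> X \<Longrightarrow> di i x y \<le> di (Suc i) x y"
    and "\<And>x y. x \<in> X \<Longrightarrow> y \<in> X \<Longrightarrow> (\<lambda>i. di i x y) \<longlonglongrightarrow> d x y"
    and "\<And>i. Metric_space.mtopology X (di i) = Metric_space.mtopology X d"
    and "\<And>i. Metric_space.boundedly_finite X (di i) m"
    and "1 < p"
  shows "(\<forall>fs f. Lp_converges_weakly m p fs f \<longrightarrow>
            Metric_space.Cheeger_energy X d m p f
              \<le> liminf (\<lambda>i. Metric_space.Cheeger_energy X (di i) m p (fs i))) \<and>
         (\<forall>f\<in>Lp m p. \<exists>fs. Lp_converges m p fs f \<and>
            Metric_space.Cheeger_energy X d m p f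
              \<ge> limsup (\<lambda>i. Metric_space.Cheeger_energy X (di i) m p (fs i)))"
proof -
  interpret D: metric_measure_space X d m by fact
  have "metric_measure_space X (di i) m" for i
    by (intro metric_measure_space.intro metric_measure_space_axioms.intro assms(2,3,7))
      (simp_all add: assms(6) D.separable D.borel)
  then interpret metrics_increasing_to X d m di p
    by (intro metrics_increasing_to.intro metrics_increasing_to_axioms.intro
        D.metric_measure_space_axioms assms(4,5,8))
  show ?thesis
  proof (intro conjI allI impI ballI)
    fix fs f assume "Lp_converges_weakly m p fs f"
    then show "D.Cheeger_energy m p f \<le> liminf (\<lambda>i. Metric_space.Cheeger_energy X (di i) m p (fs i))"
      by (rule Cheeger_energy_liminf)
  next
    fix f assume "f \<in> Lp m p"
    then obtain fs where "Lp_converges m p fs f"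
      "limsup (\<lambda>i. Metric_space.Cheeger_energy X (di i) m p (fs i)) \<le> D.Cheeger_energy m p f"
      by (rule Cheeger_energy_limsup)
    then show "\<exists>fs. Lp_converges m p fs f \<and>
        limsup (\<lambda>i. Metric_space.Cheeger_energy X (di i) m p (fs i)) \<le> D.Cheeger_energy m p f"
      by blast
  qed
qed

end
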